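(* Let $A$ be a nontrivial finite abelian group, let $\Gamma$ be an alphabet and let $G\le\llbracket\Gamma^{\mathbb{Z}}\rrbracket$ be a subgroup whose action is move-$A$ithful. Then for every alphabet $\Sigma$, the restricted wreath product $A\wr G=\left(\bigoplus_{G}A\right)\rtimes G$ embeds as a subgroup of $\llbracket\Sigma^{\mathbb{Z}}\rrbracket$.
   Context: An alphabet is a finite set with at least two elements. $\llbracket\Sigma^{\mathbb{Z}}\rrbracket$ is the group of homeomorphisms $f$ of $\Sigma^{\mathbb{Z}}$ with a continuous cocycle $c_f:\Sigma^{\mathbb{Z}}\to\mathbb{Z}$ such that $f(x)=\sigma^{c_f(x)}(x)$, where $\sigma(x)_i=x_{i+1}$; for $g\in G$ write $c_g$ for its cocycle. For a finite abelian group $A$, the action of $G$ is move-$A$ithful if for every map $\beta:G\to A$ with finite nonempty support there exist $x\in\Gamma^{\mathbb{Z}}$ and $\gamma:\mathbb{Z}\to\mathrm{End}(A)$ with $\sum_{g\in G}\gamma(c_g(x))(\beta(g))\neq0_A$. In $A\wr G$, $G$ acts on $\bigoplus_G A$ by left translation of coordinates. *)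

theory Defs
  imports "HOL-Analysis.Function_Topology" "HOL-Algebra.FiniteProduct"
begin

definition alphabet :: "'a set \<Rightarrow> bool" where
  "alphabet S \<longleftrightarrow> finite S \<and> 2 \<le> card S"

definition fullshift_top :: "'a set \<Rightarrow> (int \<Rightarrow> 'a) topology" where
  "fullshift_top S = product_topology (\<lambda>_::int. discrete_topology S) UNIV"

definition shift :: "int \<Rightarrow> (int \<Rightarrow> 'a) \<Rightarrow> (int \<Rightarrow> 'a)" where
  "shift k x = (\<lambda>i. x (i + k))"

definition is_cocycle :: "'a set \<Rightarrow> ((int \<Rightarrow> 'a) \<Rightarrow> (int \<Rightarrow> 'a)) \<Rightarrow> ((int \<Rightarrow> 'a) \<Rightarrow> int) \<Rightarrow> bool" where
  "is_cocycle S f c \<longleftrightarrow>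
     continuous_map (fullshift_top S) (discrete_topology (UNIV::int set)) c \<and>
     (\<forall>x\<in>topspace (fullshift_top S). f x = shift (c x) x)"

text \<open>The (continuous) cocycle of an element; it is unique (aperiodic points are dense).\<close>
definition cocycle :: "'a set \<Rightarrow> ((int \<Rightarrow> 'a) \<Rightarrow> (int \<Rightarrow> 'a)) \<Rightarrow> (int \<Rightarrow> 'a) \<Rightarrow> int" where
  "cocycle S f = (SOME c. is_cocycle S f c)"

definition tfg :: "'a set \<Rightarrow> ((int \<Rightarrow> 'a) \<Rightarrow> (int \<Rightarrow> 'a)) monoid" where
  "tfg S = \<lparr> carrier = {f. f \<in> extensional (topspace (fullshift_top S)) \<and>
                           homeomorphic_map (fullshift_top S) (fullshift_top S) f \<and>
                           (\<exists>c. is_cocycle S f c)},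
            monoid.mult = (\<lambda>f g. compose (topspace (fullshift_top S)) f g),
            one = restrict id (topspace (fullshift_top S)) \<rparr>"

definition move_faithful :: "('b, 'x) monoid_scheme \<Rightarrow> 'a set \<Rightarrow> ((int \<Rightarrow> 'a) \<Rightarrow> (int \<Rightarrow> 'a)) set \<Rightarrow> bool" where
  "move_faithful A \<Gamma> H \<longleftrightarrow>
     (\<forall>\<beta> \<in> H \<rightarrow> carrier A.
        finite {g \<in> H. \<beta> g \<noteq> \<one>\<^bsub>A\<^esub>} \<and> {g \<in> H. \<beta> g \<noteq> \<one>\<^bsub>A\<^esub>} \<noteq> {} \<longrightarrow>
        (\<exists>x \<in> topspace (fullshift_top \<Gamma>). \<exists>\<gamma>::int \<Rightarrow> 'b \<Rightarrow> 'b.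
           (\<forall>n. \<gamma> n \<in> hom A A) \<and>
           finprod A (\<lambda>g. \<gamma> (cocycle \<Gamma> g x) (\<beta> g)) {g \<in> H. \<beta> g \<noteq> \<one>\<^bsub>A\<^esub>} \<noteq> \<one>\<^bsub>A\<^esub>))"

definition wreath :: "('b, 'x) monoid_scheme \<Rightarrow> ('g, 'y) monoid_scheme \<Rightarrow> (('g \<Rightarrow> 'b) \<times> 'g) monoid" where
  "wreath A G = \<lparr> carrier = {(\<phi>, g). \<phi> \<in> extensional (carrier G) \<and> \<phi> \<in> carrier G \<rightarrow> carrier A \<and>
                                  finite {k \<in> carrier G. \<phi> k \<noteq> \<one>\<^bsub>A\<^esub>} \<and> g \<in> carrier G},
                 monoid.mult = (\<lambda>(\<phi>, g) (\<psi>, h).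
                    (\<lambda>k\<in>carrier G. \<phi> k \<otimes>\<^bsub>A\<^esub> \<psi> (inv\<^bsub>G\<^esub> g \<otimes>\<^bsub>G\<^esub> k), g \<otimes>\<^bsub>G\<^esub> h)),
                 one = (\<lambda>k\<in>carrier G. \<one>\<^bsub>A\<^esub>, \<one>\<^bsub>G\<^esub>) \<rparr>"

end

(*
  Suppose that T in [[Sigma^Z]] commutes with an action alpha of A by elements of [[Sigma^Z]], and
  that lab is a locally constant, alpha-invariant function with values in Gamma x End(A). Reading lab
  along the T-orbit of x gives z in Gamma^Z and gamma : Z -> End(A). Then g in G acts by
  x |-> T^(c_g(z)) x, and beta in (+)_G A acts by x |-> alpha(sum_k gamma(c_(k^-1)(z))(beta(k))) x; the
  cocycle identity shows that together they define an action of the wreath product. It is faithful by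
  move-faithfulness, provided that every pair (z, gamma) is read off at a point on which alpha is free.

  For T take a conveyor belt. Runs of consecutive code cells in x carry two tracks, and T moves one cell
  along a track, turning to the other track at the end of a run. T is the product of two involutions,
  one that switches tracks within a cell and one that switches them while crossing to a neighbouring
  cell. The state of x, that is, the track and an element of A, is the position of the origin within
  its cell; alpha changes the second component.
*)
theory Submission
  imports Defs
begin

section \<open>Locally constant functions and topological full groups\<close>

abbreviation full :: "'s set \<Rightarrow> (int \<Rightarrow> 's) set" where
  "full S \<equiv> topspace (fullshift_top S)"

lemma in_full_iff: "x \<in> full S \<longleftrightarrow> (\<forall>i. x i \<in> S)"
  by (auto simp: fullshift_top_def PiE_def)

lemma shift_apply: "shift k x i = x (i + k)"
  by (simp add: shift_def)

lemma shift_shift [simp]: "shift k (shift l x) = shift (k + l) x"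
  by (auto simp: shift_def algebra_simps)

lemma shift_0 [simp]: "shift 0 x = x"
  by (auto simp: shift_def)

lemma shift_in_full [simp]: "shift k x \<in> full S \<longleftrightarrow> x \<in> full S"
proof
  assume "shift k x \<in> full S"
  then have "shift k x (i - k) \<in> S" for i
    unfolding in_full_iff by blast
  then show "x \<in> full S"
    by (simp add: in_full_iff shift_apply)
qed (simp add: in_full_iff shift_apply)

text \<open>Continuity into a discrete space, phrased with windows. The radius \<open>n\<close> may
  depend on \<open>x\<close>, so that no appeal to compactness is made.\<close>

definition local_const :: "'s set \<Rightarrow> ((int \<Rightarrow> 's) \<Rightarrow> 'd) \<Rightarrow> bool" where
  "local_const S c \<longleftrightarrow>
     (\<forall>x\<in>full S. \<exists>n. \<forall>y\<in>full S. (\<forall>i. \<bar>i\<bar> \<le> n \<longrightarrow> y i = x i) \<longrightarrow> c y = c x)"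

lemma local_constE:
  assumes "local_const S c" "x \<in> full S"
  obtains n where "\<And>y. y \<in> full S \<Longrightarrow> (\<And>i. \<bar>i\<bar> \<le> n \<Longrightarrow> y i = x i) \<Longrightarrow> c y = c x"
  using assms unfolding local_const_def by meson

text \<open>A basic open set of the product topology restricts only finitely many coordinates, and
  these lie in one window; conversely a window defines a basic open set.\<close>

lemma continuous_map_discrete_iff:
  "continuous_map (fullshift_top S) (discrete_topology U) c \<longleftrightarrow> c \<in> full S \<rightarrow> U \<and> local_const S c"
proof (intro iffI conjI)
  assume c: "continuous_map (fullshift_top S) (discrete_topology U) c"
  then show cU: "c \<in> full S \<rightarrow> U"
    by (auto simp: continuous_map_def)
  show "local_const S c"
    unfolding local_const_def
  proof
    fix x assume x: "x \<in> full S"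
    have "openin (fullshift_top S) {y \<in> full S. c y \<in> {c x}}"
      using c cU x by (intro openin_continuous_map_preimage[OF c]) auto
    then have "\<exists>W. finite {i. W i \<noteq> S} \<and> x \<in> Pi\<^sub>E UNIV W \<and> Pi\<^sub>E UNIV W \<subseteq> {y \<in> full S. c y \<in> {c x}}"
      using x unfolding fullshift_top_def openin_product_topology_alt by simp blast
    then obtain W where W: "finite {i. W i \<noteq> S}" "x \<in> Pi\<^sub>E UNIV W"
      "Pi\<^sub>E UNIV W \<subseteq> {y \<in> full S. c y \<in> {c x}}"
      by blast
    obtain n where n: "\<And>i. W i \<noteq> S \<Longrightarrow> \<bar>i\<bar> \<le> n"
      using bdd_above_finite[OF finite_imageI[OF W(1), of abs]] unfolding bdd_above_def by blast
    show "\<exists>n. \<forall>y\<in>full S. (\<forall>i. \<bar>i\<bar> \<le> n \<longrightarrow> y i = x i) \<longrightarrow> c y = c x"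
    proof (intro exI ballI impI)
      fix y assume y: "y \<in> full S" and a: "\<forall>i. \<bar>i\<bar> \<le> n \<longrightarrow> y i = x i"
      have "y i \<in> W i" for i
        using n[of i] a y W(2) by (cases "W i = S") (auto simp: in_full_iff PiE_iff)
      then show "c y = c x" using W(3) by auto
    qed
  qed
next
  assume c: "c \<in> full S \<rightarrow> U \<and> local_const S c"
  show "continuous_map (fullshift_top S) (discrete_topology U) c"
    unfolding continuous_map_def
  proof (intro conjI allI impI)
    fix V assume "openin (discrete_topology U) V"
    show "openin (fullshift_top S) {x \<in> full S. c x \<in> V}"
    proof (subst openin_subopen, intro ballI)
      fix x assume "x \<in> {x \<in> full S. c x \<in> V}"
      then have x: "x \<in> full S" "c x \<in> V" by auto
      then obtain n where n: "\<And>y. y \<in> full S \<Longrightarrow> (\<And>i. \<bar>i\<bar> \<le> n \<Longrightarrow> y i = x i) \<Longrightarrow> c y = c x"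
        using c local_constE by blast
      let ?W = "\<lambda>i. if \<bar>i\<bar> \<le> n then {x i} else S"
      have "finite {i. ?W i \<noteq> S}"
        by (rule finite_subset[of _ "{-n..n}"]) (auto split: if_splits)
      then have "openin (fullshift_top S) (Pi\<^sub>E UNIV ?W)"
        using x unfolding fullshift_top_def
        by (intro product_topology_basis) (auto simp: in_full_iff)
      moreover have "Pi\<^sub>E UNIV ?W \<subseteq> {x \<in> full S. c x \<in> V}"
      proof
        fix y assume y: "y \<in> Pi\<^sub>E UNIV ?W"
        have *: "y i \<in> ?W i" for i using y by (auto simp: PiE_iff)
        have "y \<in> full S"
          unfolding in_full_iff using * x(1) by (metis in_full_iff singletonD)
        moreover have "c y = c x"
          using * by (intro n[OF \<open>y \<in> full S\<close>]) (metis singletonD)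
        ultimately show "y \<in> {x \<in> full S. c x \<in> V}" using x by simp
      qed
      moreover have "x \<in> Pi\<^sub>E UNIV ?W"
        using x by (auto simp: PiE_iff in_full_iff)
      ultimately show "\<exists>T. openin (fullshift_top S) T \<and> x \<in> T \<and> T \<subseteq> {x \<in> full S. c x \<in> V}"
        by blast
    qed
  qed (use c in auto)
qed

lemma local_const_const [simp]: "local_const S (\<lambda>_. d)"
  by (simp add: local_const_def)

text \<open>Where \<open>c\<close> keeps its value at \<open>x\<close>, the function to be evaluated
  is the fixed \<open>f (c x)\<close>; the larger of the two windows works. The other closure
  properties reduce to this one.\<close>

lemma local_const_bind:
  assumes "local_const S c" "\<And>k. local_const S (f k)"
  shows "local_const S (\<lambda>x. f (c x) x)"
  unfolding local_const_def
proof
  fix x assume x: "x \<in> full S"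
  obtain n where n: "\<And>y. y \<in> full S \<Longrightarrow> (\<And>i. \<bar>i\<bar> \<le> n \<Longrightarrow> y i = x i) \<Longrightarrow> c y = c x"
    using local_constE[OF assms(1) x] by blast
  obtain m
    where m: "\<And>y. y \<in> full S \<Longrightarrow> (\<And>i. \<bar>i\<bar> \<le> m \<Longrightarrow> y i = x i) \<Longrightarrow> f (c x) y = f (c x) x"
    using local_constE[OF assms(2) x] by blast
  show "\<exists>n. \<forall>y\<in>full S. (\<forall>i. \<bar>i\<bar> \<le> n \<longrightarrow> y i = x i) \<longrightarrow> f (c y) y = f (c x) x"
    by (rule exI[of _ "max m n"]) (use n m in auto)
qed

lemma local_const_comp:
  "local_const S c \<Longrightarrow> local_const S (\<lambda>x. h (c x))"
  by (rule local_const_bind[where f = "\<lambda>k _. h k"]) simp_all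

lemma local_const_comp2:
  "local_const S c \<Longrightarrow> local_const S d \<Longrightarrow> local_const S (\<lambda>x. h (c x) (d x))"
  by (rule local_const_bind[where f = "\<lambda>k x. h k (d x)"]) (simp_all add: local_const_comp)

lemma local_const_cong:
  assumes "local_const S c" "\<And>x. x \<in> full S \<Longrightarrow> d x = c x"
  shows "local_const S d"
  using assms unfolding local_const_def by metis

lemma local_const_window:
  assumes "\<And>x y. (\<And>i. \<bar>i\<bar> \<le> n \<Longrightarrow> y i = x i) \<Longrightarrow> c y = c x"
  shows "local_const S c"
  unfolding local_const_def using assms by blast

lemma local_const_coord: "local_const S (\<lambda>x. x i)"
  by (rule local_const_window[of "\<bar>i\<bar>"]) simp

text \<open>Bundles finitely many functions into a single one, so that
  \<open>local_const_comp\<close> applies to anything computed from all of them.\<close>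

lemma local_const_finite:
  assumes "finite F" "\<And>k. k \<in> F \<Longrightarrow> local_const S (t k)"
  shows "local_const S (\<lambda>x. restrict (\<lambda>k. t k x) F)"
  using assms
proof (induction F)
  case empty
  then show ?case by simp
next
  case (insert a F)
  have "local_const S (\<lambda>x. (\<lambda>v r. r(a := v)) (t a x) (restrict (\<lambda>k. t k x) F))"
    by (rule local_const_comp2[where h = "\<lambda>v r. r(a := v)", OF insert.prems insert.IH])
      (use insert.prems in blast)+
  then show ?case
    by (rule local_const_cong) (use insert in \<open>auto simp: restrict_def\<close>)
qed

text \<open>Near \<open>f x\<close>, the function \<open>c\<close> looks at finitely many
  coordinates of its argument only, and each of them is locally constant in
  \<open>x\<close>.\<close>

lemma local_const_map:
  assumes c: "local_const S' c"
    and maps: "\<And>x. x \<in> full S \<Longrightarrow> f x \<in> full S'"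
    and f: "\<And>i. local_const S (\<lambda>x. f x i)"
  shows "local_const S (\<lambda>x. c (f x))"
  unfolding local_const_def
proof
  fix x assume x: "x \<in> full S"
  obtain n
    where n: "\<And>y. y \<in> full S' \<Longrightarrow> (\<And>i. \<bar>i\<bar> \<le> n \<Longrightarrow> y i = f x i) \<Longrightarrow> c y = c (f x)"
    using local_constE[OF c maps[OF x]] by blast
  have lc: "local_const S (\<lambda>x. restrict (f x) {-n..n})"
    by (rule local_const_finite) (use f in auto)
  obtain m
    where m: "\<And>y. y \<in> full S \<Longrightarrow> (\<And>i. \<bar>i\<bar> \<le> m \<Longrightarrow> y i = x i) \<Longrightarrow>
      restrict (f y) {-n..n} = restrict (f x) {-n..n}"
    using local_constE[OF lc x] by blast
  have "f y i = f x i" if "y \<in> full S" "\<And>i. \<bar>i\<bar> \<le> m \<Longrightarrow> y i = x i" "\<bar>i\<bar> \<le> n" for y i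
    using fun_cong[OF m[OF that(1,2)], of i] that(3) by (auto simp: restrict_def abs_le_iff split: if_splits)
  then show "\<exists>n. \<forall>y\<in>full S. (\<forall>i. \<bar>i\<bar> \<le> n \<longrightarrow> y i = x i) \<longrightarrow> c (f y) = c (f x)"
    using n maps by meson
qed

lemma local_const_shift_by:
  assumes "local_const S c" "local_const S k"
  shows "local_const S (\<lambda>x. c (shift (k x) x))"
proof (rule local_const_bind[where f = "\<lambda>k x. c (shift k x)", OF assms(2)])
  show "local_const S (\<lambda>x. c (shift k x))" for k
    by (rule local_const_map[OF assms(1)]) (auto simp: shift_apply intro: local_const_coord)
qed

lemma local_const_shift:
  "local_const S c \<Longrightarrow> local_const S (\<lambda>x. c (shift k x))"
  by (rule local_const_shift_by) simp_all

section \<open>Elements of the topological full group and their composition\<close>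

lemma is_cocycle_iff:
  "is_cocycle S f c \<longleftrightarrow> local_const S c \<and> (\<forall>x\<in>full S. f x = shift (c x) x)"
  by (auto simp: is_cocycle_def continuous_map_discrete_iff)

lemma continuous_map_shift_by:
  assumes "local_const S c" "\<And>x. x \<in> full S \<Longrightarrow> f x = shift (c x) x"
  shows "continuous_map (fullshift_top S) (fullshift_top S) f"
proof -
  have "continuous_map (fullshift_top S) (discrete_topology S) (\<lambda>x. f x i)" for i
    unfolding continuous_map_discrete_iff
  proof
    show "local_const S (\<lambda>x. f x i)"
      by (rule local_const_cong[OF local_const_shift_by[OF local_const_coord assms(1)]])
        (simp add: assms(2))
  qed (auto simp: assms(2) in_full_iff shift_apply)
  then show ?thesis
    unfolding fullshift_top_def[of S] by (subst continuous_map_componentwise_UNIV) (simp add: fullshift_top_def)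
qed

text \<open>Membership is proved by exhibiting an inverse that is itself a shift by a locally
  constant amount; both maps are then continuous.\<close>

lemma tfgI:
  assumes "f \<in> extensional (full S)"
    and "local_const S c" "\<And>x. x \<in> full S \<Longrightarrow> f x = shift (c x) x"
    and "local_const S d" "\<And>x. x \<in> full S \<Longrightarrow> g x = shift (d x) x"
    and "\<And>x. x \<in> full S \<Longrightarrow> g (f x) = x" "\<And>x. x \<in> full S \<Longrightarrow> f (g x) = x"
  shows "f \<in> carrier (tfg S)"
proof -
  have "homeomorphic_maps (fullshift_top S) (fullshift_top S) f g"
    unfolding homeomorphic_maps_def using assms continuous_map_shift_by by metis
  then show ?thesis
    using assms by (auto simp: tfg_def is_cocycle_iff intro: homeomorphic_maps_imp_map)
qed

lemma tfg_mult: "x \<in> full S \<Longrightarrow> (f \<otimes>\<^bsub>tfg S\<^esub> g) x = f (g x)"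
  by (simp add: tfg_def compose_def)

lemma tfg_one: "x \<in> full S \<Longrightarrow> \<one>\<^bsub>tfg S\<^esub> x = x"
  by (simp add: tfg_def)

lemma tfg_eqI:
  assumes "f \<in> carrier (tfg S)" "g \<in> carrier (tfg S)" "\<And>x. x \<in> full S \<Longrightarrow> f x = g x"
  shows "f = g"
  using assms by (auto simp: tfg_def intro: extensionalityI)

lemma tfg_cocycle:
  assumes "f \<in> carrier (tfg S)"
  obtains c where "local_const S c" "\<And>x. x \<in> full S \<Longrightarrow> f x = shift (c x) x"
  using assms by (auto simp: tfg_def is_cocycle_iff)

lemma tfg_maps:
  assumes "f \<in> carrier (tfg S)" "x \<in> full S"
  shows "f x \<in> full S"
  using tfg_cocycle[OF assms(1)] assms(2) by (metis shift_in_full)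

lemma tfg_local_const:
  assumes "f \<in> carrier (tfg S)" "local_const S c"
  shows "local_const S (\<lambda>x. c (f x))"
proof -
  from tfg_cocycle[OF assms(1)] obtain k
    where k: "local_const S k" "\<And>x. x \<in> full S \<Longrightarrow> f x = shift (k x) x" by blast
  show ?thesis
    by (rule local_const_cong[OF local_const_shift_by[OF assms(2) k(1)]]) (simp add: k(2))
qed

lemma tfg_inverse_ex:
  assumes "f \<in> carrier (tfg S)"
  shows "\<exists>g\<in>carrier (tfg S). g \<otimes>\<^bsub>tfg S\<^esub> f = \<one>\<^bsub>tfg S\<^esub>"
proof -
  from assms obtain g where g: "homeomorphic_maps (fullshift_top S) (fullshift_top S) f g"
    by (auto simp: tfg_def homeomorphic_map_maps)
  from tfg_cocycle[OF assms] obtain c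
    where c: "local_const S c" "\<And>x. x \<in> full S \<Longrightarrow> f x = shift (c x) x" by blast
  have gX: "g x \<in> full S" if "x \<in> full S" for x
    using g that by (auto simp: homeomorphic_maps_def continuous_map_def)
  have fg: "f (g x) = x" "g (f x) = x" if "x \<in> full S" for x
    using g that by (auto simp: homeomorphic_maps_def)
  \<comment> \<open>Solving \<open>x = f (g x) = shift (c (g x)) (g x)\<close> for
    \<open>g x\<close> yields the cocycle of the inverse.\<close>
  let ?d = "\<lambda>x. - c (g x)" and ?g = "restrict g (full S)"
  have "continuous_map (fullshift_top S) (discrete_topology UNIV) (c \<circ> g)"
    using g c(1) unfolding homeomorphic_maps_def
    by (intro continuous_map_compose[where X' = "fullshift_top S"]) (auto simp: continuous_map_discrete_iff)
  then have d: "local_const S ?d"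
    using local_const_comp[of S "c \<circ> g" uminus] by (simp add: continuous_map_discrete_iff o_def)
  have gd: "?g x = shift (?d x) x" if "x \<in> full S" for x
  proof -
    have "shift (?d x) x = shift (?d x) (f (g x))" using fg that by simp
    also have "\<dots> = g x" using c(2)[OF gX[OF that]] by simp
    finally show ?thesis using that by simp
  qed
  have "?g \<in> carrier (tfg S)"
    by (rule tfgI[OF restrict_extensional d gd c]) (simp_all add: fg gX tfg_maps[OF assms])
  moreover have "?g \<otimes>\<^bsub>tfg S\<^esub> f = \<one>\<^bsub>tfg S\<^esub>"
    by (rule ext) (simp add: tfg_def compose_def restrict_def fg tfg_maps[OF assms])
  ultimately show ?thesis by (rule bexI[of _ ?g, rotated])
qed

lemma tfg_mult_cocycle:
  assumes "local_const S d" "\<And>x. x \<in> full S \<Longrightarrow> g x = shift (d x) x"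
    and "local_const S c" "\<And>x. x \<in> full S \<Longrightarrow> f x = shift (c x) x"
  shows "local_const S (\<lambda>x. c (g x) + d x)" "\<And>x. x \<in> full S \<Longrightarrow> f (g x) = shift (c (g x) + d x) x"
proof -
  have "local_const S (\<lambda>x. c (g x))"
    by (rule local_const_cong[OF local_const_shift_by[OF assms(3,1)]]) (simp add: assms(2))
  then show "local_const S (\<lambda>x. c (g x) + d x)"
    using assms(1) by (rule local_const_comp2)
  show "f (g x) = shift (c (g x) + d x) x" if x: "x \<in> full S" for x
  proof -
    have "f (g x) = shift (c (g x)) (g x)" by (rule assms(4)) (simp add: assms(2)[OF x] x)
    also have "\<dots> = shift (c (g x)) (shift (d x) x)" by (simp only: assms(2)[OF x])
    finally show ?thesis by simp
  qed
qed

lemma tfg_one_closed: "\<one>\<^bsub>tfg S\<^esub> \<in> carrier (tfg S)"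
  by (rule tfgI[where c = "\<lambda>_. 0" and d = "\<lambda>_. 0" and g = id]) (auto simp: tfg_def)

lemma tfg_mult_closed:
  assumes f: "f \<in> carrier (tfg S)" and g: "g \<in> carrier (tfg S)"
  shows "f \<otimes>\<^bsub>tfg S\<^esub> g \<in> carrier (tfg S)"
proof -
  obtain c where c: "local_const S c" "\<And>x. x \<in> full S \<Longrightarrow> f x = shift (c x) x"
    using tfg_cocycle[OF f] by blast
  obtain d where d: "local_const S d" "\<And>x. x \<in> full S \<Longrightarrow> g x = shift (d x) x"
    using tfg_cocycle[OF g] by blast
  have "is_cocycle S (f \<otimes>\<^bsub>tfg S\<^esub> g) (\<lambda>x. c (g x) + d x)"
    using tfg_mult_cocycle[OF d c] by (simp add: is_cocycle_iff tfg_mult)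
  then have "\<exists>c. is_cocycle S (f \<otimes>\<^bsub>tfg S\<^esub> g) c"
    by (intro exI)
  moreover have "homeomorphic_map (fullshift_top S) (fullshift_top S) (f \<otimes>\<^bsub>tfg S\<^esub> g)"
    using f g homeomorphic_map_eq[OF homeomorphic_map_compose[of "fullshift_top S" "fullshift_top S" g "fullshift_top S" f]]
    by (auto simp: tfg_def compose_def)
  ultimately show ?thesis
    by (simp add: tfg_def compose_def)
qed

lemma tfg_group: "group (tfg S)"
proof (rule groupI)
  fix f g h assume *: "f \<in> carrier (tfg S)" "g \<in> carrier (tfg S)" "h \<in> carrier (tfg S)"
  show "f \<otimes>\<^bsub>tfg S\<^esub> g \<otimes>\<^bsub>tfg S\<^esub> h = f \<otimes>\<^bsub>tfg S\<^esub> (g \<otimes>\<^bsub>tfg S\<^esub> h)"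
    by (rule tfg_eqI[of _ S]) (use * in \<open>simp_all add: tfg_mult_closed tfg_mult tfg_maps\<close>)
next
  fix f assume *: "f \<in> carrier (tfg S)"
  show "\<one>\<^bsub>tfg S\<^esub> \<otimes>\<^bsub>tfg S\<^esub> f = f"
    by (rule tfg_eqI[of _ S]) (use * in \<open>simp_all add: tfg_mult_closed tfg_mult tfg_maps tfg_one tfg_one_closed\<close>)
qed (auto intro: tfg_one_closed tfg_mult_closed tfg_inverse_ex)

section \<open>Uniqueness of cocycles and the cocycle identity\<close>

lemma alphabet_distinct:
  assumes "alphabet S"
  obtains s t where "s \<in> S" "t \<in> S" "s \<noteq> t"
proof -
  have "\<not> card S \<le> Suc 0" "finite S" using assms by (auto simp: alphabet_def)
  then show ?thesis using that card_le_Suc0_iff_eq by blast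
qed

text \<open>Configurations that are eventually constant with different values at the two ends are aperiodic,
  and they are dense.\<close>
lemma cocycle_unique:
  assumes S: "alphabet S"
    and c: "local_const S c" "\<And>x. x \<in> full S \<Longrightarrow> f x = shift (c x) x"
    and d: "local_const S d" "\<And>x. x \<in> full S \<Longrightarrow> f x = shift (d x) x"
    and x: "x \<in> full S"
  shows "c x = d x"
proof -
  obtain s t where st: "s \<in> S" "t \<in> S" "s \<noteq> t"
    using alphabet_distinct[OF S] by blast
  have "local_const S (\<lambda>x. (c x, d x))"
    using c(1) d(1) by (rule local_const_comp2)
  from this x obtain n
    where n: "\<And>y. y \<in> full S \<Longrightarrow> (\<And>i. \<bar>i\<bar> \<le> n \<Longrightarrow> y i = x i) \<Longrightarrow> (c y, d y) = (c x, d x)"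
    by (rule local_constE) blast
  \<comment> \<open>\<open>y\<close> copies \<open>x\<close> on a window that determines both
    cocycles, and has tails \<open>s\<close> on the left and \<open>t\<close> on the right.\<close>
  define y where "y = (\<lambda>i. if \<bar>i\<bar> \<le> n then x i else if i < 0 then s else t)"
  have y: "y \<in> full S" using x st by (auto simp: y_def in_full_iff)
  have cd: "c y = c x" "d y = d x" using n[OF y] by (auto simp: y_def)
  have "k = 0" if k: "shift k y = y" for k
  proof (rule ccontr)
    assume "k \<noteq> 0"
    have per: "y (i + int j * k) = y i" for i j
    proof (induction j)
      case (Suc j)
      have "y (i + int (Suc j) * k) = shift k y (i + int j * k)" by (simp add: shift_apply algebra_simps)
      with k Suc show ?case by simp
    qed simp
    \<comment> \<open>A multiple \<open>M\<close> of the period longer than the window carries a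
      suitable \<open>i\<close> just outside the window into the opposite tail. The radius
      \<open>n\<close> may be negative, hence the absolute values.\<close>
    define N where "N = nat (2 * \<bar>n\<bar> + 2)"
    define M where "M = int N * k"
    have "\<bar>M\<bar> \<ge> int N * 1"
      unfolding M_def abs_mult using \<open>k \<noteq> 0\<close> by (intro mult_mono) auto
    then have M: "\<bar>M\<bar> \<ge> 2 * \<bar>n\<bar> + 2" by (simp add: N_def)
    define i where "i = (if M > 0 then - (\<bar>n\<bar> + 1) else \<bar>n\<bar> + 1)"
    have "\<bar>i\<bar> > n \<and> \<bar>i + M\<bar> > n \<and> (i < 0) \<noteq> (i + M < 0)"
      using M by (auto simp: i_def)
    then have "y (i + int N * k) \<noteq> y i"
      unfolding M_def[symmetric] using st by (auto simp: y_def)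
    with per show False by blast
  qed
  moreover have "shift (c y - d y) y = y"
  proof -
    have "shift (- d y) (shift (c y) y) = shift (- d y) (shift (d y) y)"
      by (simp only: c(2)[OF y, symmetric] d(2)[OF y, symmetric])
    then show ?thesis by simp
  qed
  ultimately have "c y - d y = 0" by blast
  with cd show ?thesis by simp
qed

lemma cocycle_props:
  assumes "g \<in> carrier (tfg S)"
  shows "local_const S (cocycle S g)" "\<And>x. x \<in> full S \<Longrightarrow> g x = shift (cocycle S g x) x"
proof -
  have "is_cocycle S g (cocycle S g)"
    unfolding cocycle_def using assms by (intro someI_ex[of "is_cocycle S g"]) (simp add: tfg_def)
  then show "local_const S (cocycle S g)" "\<And>x. x \<in> full S \<Longrightarrow> g x = shift (cocycle S g x) x"
    by (auto simp: is_cocycle_iff)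
qed

text \<open>\<open>cocycle\<close> is an arbitrary choice, so the identity rests on uniqueness: the
  right-hand side is a continuous cocycle of the product as well.\<close>

lemma cocycle_mult:
  assumes S: "alphabet S" and g: "g \<in> carrier (tfg S)" and h: "h \<in> carrier (tfg S)" and x: "x \<in> full S"
  shows "cocycle S (g \<otimes>\<^bsub>tfg S\<^esub> h) x = cocycle S g (h x) + cocycle S h x"
proof (rule cocycle_unique[OF S cocycle_props[OF tfg_mult_closed[OF g h]] _ _ x])
  note m = tfg_mult_cocycle[OF cocycle_props[OF h] cocycle_props[OF g]]
  show "local_const S (\<lambda>x. cocycle S g (h x) + cocycle S h x)" by (rule m(1)) auto
  show "(g \<otimes>\<^bsub>tfg S\<^esub> h) x = shift (cocycle S g (h x) + cocycle S h x) x" if "x \<in> full S" for x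
    using m(2)[of x] that by (simp add: tfg_mult)
qed auto

text \<open>The cocycle identity for the product of the identity with itself reads
  \<open>c = c + c\<close>.\<close>

lemma cocycle_one:
  assumes "alphabet S" "x \<in> full S"
  shows "cocycle S \<one>\<^bsub>tfg S\<^esub> x = 0"
  using cocycle_mult[OF assms(1) tfg_one_closed tfg_one_closed assms(2)]
    monoid.l_one[OF group.is_monoid[OF tfg_group] tfg_one_closed, of S] assms(2)
  by (simp add: tfg_one)

section \<open>Wreath products acting through a labelled action\<close>

text \<open>\<open>sym\<close> and \<open>endo\<close> are the two components of the label. Freeness
  of \<open>\<alpha>\<close> is not assumed here; it enters only through the hypothesis
  \<open>rich\<close> of \<open>emb_inj\<close>.\<close>

locale labelled_action =
  fixes A :: "('b, 'x) monoid_scheme"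
    and \<Gamma> :: "'a set"
    and H :: "((int \<Rightarrow> 'a) \<Rightarrow> (int \<Rightarrow> 'a)) set"
    and \<Sigma> :: "'c set"
    and T :: "(int \<Rightarrow> 'c) \<Rightarrow> (int \<Rightarrow> 'c)"
    and \<alpha> :: "'b \<Rightarrow> (int \<Rightarrow> 'c) \<Rightarrow> (int \<Rightarrow> 'c)"
    and sym :: "(int \<Rightarrow> 'c) \<Rightarrow> 'a"
    and endo :: "(int \<Rightarrow> 'c) \<Rightarrow> 'b \<Rightarrow> 'b"
  assumes A: "comm_group A"
    and \<Gamma>: "alphabet \<Gamma>"
    and H: "subgroup H (tfg \<Gamma>)"
    and T: "T \<in> carrier (tfg \<Sigma>)"
    and \<alpha>: "\<alpha> \<in> hom A (tfg \<Sigma>)"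
    and commute: "\<And>a x. a \<in> carrier A \<Longrightarrow> x \<in> full \<Sigma> \<Longrightarrow> T (\<alpha> a x) = \<alpha> a (T x)"
    and sym_lc: "local_const \<Sigma> sym"
    and sym_in: "\<And>x. x \<in> full \<Sigma> \<Longrightarrow> sym x \<in> \<Gamma>"
    and sym_\<alpha>: "\<And>a x. a \<in> carrier A \<Longrightarrow> x \<in> full \<Sigma> \<Longrightarrow> sym (\<alpha> a x) = sym x"
    and endo_lc: "local_const \<Sigma> endo"
    and endo_in: "\<And>x. x \<in> full \<Sigma> \<Longrightarrow> endo x \<in> hom A A"
    and endo_\<alpha>: "\<And>a x. a \<in> carrier A \<Longrightarrow> x \<in> full \<Sigma> \<Longrightarrow> endo (\<alpha> a x) = endo x"
begin

interpretation A: comm_group A by (rule A)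
interpretation TG: group "tfg \<Gamma>" by (rule tfg_group)
interpretation TS: group "tfg \<Sigma>" by (rule tfg_group)

definition G where "G = (tfg \<Gamma>)\<lparr>carrier := H\<rparr>"

lemma G_simps [simp]: "carrier G = H" "monoid.mult G = monoid.mult (tfg \<Gamma>)" "\<one>\<^bsub>G\<^esub> = \<one>\<^bsub>tfg \<Gamma>\<^esub>"
  by (simp_all add: G_def)

lemma G_group: "group G"
  unfolding G_def by (rule TG.subgroup_imp_group[OF H])

interpretation G: group G by (rule G_group)

lemma H_tfg: "g \<in> H \<Longrightarrow> g \<in> carrier (tfg \<Gamma>)"
  using subgroup.subset[OF H] by blast

section \<open>Powers of \<open>T\<close> and the configurations read along its orbits\<close>

definition Tpow :: "int \<Rightarrow> (int \<Rightarrow> 'c) \<Rightarrow> (int \<Rightarrow> 'c)" where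
  "Tpow k = T [^]\<^bsub>tfg \<Sigma>\<^esub> k"

lemma Tpow_closed: "Tpow k \<in> carrier (tfg \<Sigma>)"
  by (simp add: Tpow_def T)

lemma Tpow_full [simp]: "x \<in> full \<Sigma> \<Longrightarrow> Tpow k x \<in> full \<Sigma>"
  by (rule tfg_maps[OF Tpow_closed])

lemma Tpow_add: "x \<in> full \<Sigma> \<Longrightarrow> Tpow (i + j) x = Tpow i (Tpow j x)"
  by (simp add: Tpow_def TS.int_pow_mult[OF T] tfg_mult)

lemma Tpow_0: "x \<in> full \<Sigma> \<Longrightarrow> Tpow 0 x = x"
  by (simp add: Tpow_def tfg_one)

lemma Tpow_1: "Tpow 1 = T"
  by (simp add: Tpow_def T TS.int_pow_1)

lemma \<alpha>_closed: "a \<in> carrier A \<Longrightarrow> \<alpha> a \<in> carrier (tfg \<Sigma>)"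
  using \<alpha> by (rule hom_in_carrier)

lemma \<alpha>_full [simp]: "a \<in> carrier A \<Longrightarrow> x \<in> full \<Sigma> \<Longrightarrow> \<alpha> a x \<in> full \<Sigma>"
  by (rule tfg_maps[OF \<alpha>_closed])

lemma \<alpha>_mult: "a \<in> carrier A \<Longrightarrow> b \<in> carrier A \<Longrightarrow> x \<in> full \<Sigma> \<Longrightarrow> \<alpha> (a \<otimes>\<^bsub>A\<^esub> b) x = \<alpha> a (\<alpha> b x)"
  using hom_mult[OF \<alpha>] by (simp add: tfg_mult)

lemma \<alpha>_one: "x \<in> full \<Sigma> \<Longrightarrow> \<alpha> \<one>\<^bsub>A\<^esub> x = x"
  using hom_one[OF \<alpha> A.is_group tfg_group] by (simp add: tfg_one)

lemma Tpow_\<alpha>: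
  assumes a: "a \<in> carrier A" and x: "x \<in> full \<Sigma>"
  shows "Tpow k (\<alpha> a x) = \<alpha> a (Tpow k x)"
proof -
  have nat: "Tpow (int n) (\<alpha> a x) = \<alpha> a (Tpow (int n) x)" if x: "x \<in> full \<Sigma>" for n x
  proof (induction n)
    case 0
    then show ?case using a x by (simp add: Tpow_0)
  next
    case (Suc n)
    have "Tpow (1 + int n) (\<alpha> a x) = \<alpha> a (Tpow (1 + int n) x)"
      using Suc a x by (simp add: Tpow_add Tpow_1 commute)
    then show ?case by simp
  qed
  show ?thesis
  proof (cases k rule: int_cases2)
    case (nonneg n)
    then show ?thesis using nat x by simp
  next
    case (nonpos n)
    \<comment> \<open>For negative \<open>k\<close> the nonnegative case is applied at
      \<open>Tpow k x\<close> and the powers are cancelled.\<close>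
    let ?y = "Tpow k x"
    have "\<alpha> a ?y = Tpow k (Tpow (int n) (\<alpha> a ?y))"
      using a x nonpos by (simp add: Tpow_add[symmetric] Tpow_0)
    also have "\<dots> = Tpow k (\<alpha> a (Tpow (int n) ?y))" using nat x by simp
    also have "Tpow (int n) ?y = x"
      using x nonpos by (simp add: Tpow_add[symmetric] Tpow_0)
    finally show ?thesis by simp
  qed
qed

definition zcfg :: "(int \<Rightarrow> 'c) \<Rightarrow> int \<Rightarrow> 'a" where
  "zcfg x = (\<lambda>i. sym (Tpow i x))"

definition ecfg :: "(int \<Rightarrow> 'c) \<Rightarrow> int \<Rightarrow> 'b \<Rightarrow> 'b" where
  "ecfg x = (\<lambda>i. endo (Tpow i x))"

lemma zcfg_full [simp]: "x \<in> full \<Sigma> \<Longrightarrow> zcfg x \<in> full \<Gamma>"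
  by (simp add: zcfg_def in_full_iff[of _ \<Gamma>] sym_in)

lemma ecfg_in: "x \<in> full \<Sigma> \<Longrightarrow> ecfg x i \<in> hom A A"
  by (simp add: ecfg_def endo_in)

lemma ecfg_closed [simp]: "x \<in> full \<Sigma> \<Longrightarrow> a \<in> carrier A \<Longrightarrow> ecfg x i a \<in> carrier A"
  using ecfg_in hom_in_carrier by metis

text \<open>Moving the starting point along the orbit only re-indexes the readings; this turns
  powers of \<open>T\<close> on one full shift into shifts on the other.\<close>

lemma cfg_Tpow:
  assumes "x \<in> full \<Sigma>"
  shows "zcfg (Tpow k x) = shift k (zcfg x)" "ecfg (Tpow k x) = shift k (ecfg x)"
  using assms by (auto simp: zcfg_def ecfg_def shift_def Tpow_add)

lemma cfg_\<alpha>: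
  assumes "x \<in> full \<Sigma>" "a \<in> carrier A"
  shows "zcfg (\<alpha> a x) = zcfg x" "ecfg (\<alpha> a x) = ecfg x"
  using assms by (auto simp: zcfg_def ecfg_def Tpow_\<alpha> sym_\<alpha> endo_\<alpha>)

lemma zcfg_lc: "local_const \<Sigma> (\<lambda>x. zcfg x i)"
  unfolding zcfg_def by (rule tfg_local_const[OF Tpow_closed sym_lc])

lemma ecfg_lc: "local_const \<Sigma> (\<lambda>x. ecfg x i)"
  unfolding ecfg_def by (rule tfg_local_const[OF Tpow_closed endo_lc])

section \<open>The action of \<open>H\<close> by moving along orbits of \<open>T\<close>\<close>

abbreviation cc where "cc \<equiv> cocycle \<Gamma>"

lemma cc_lc: "g \<in> H \<Longrightarrow> local_const \<Sigma> (\<lambda>x. cc g (zcfg x))"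
  by (rule local_const_map[OF cocycle_props(1)[OF H_tfg] _ zcfg_lc]) auto

lemma cc_mult:
  "g \<in> H \<Longrightarrow> h \<in> H \<Longrightarrow> z \<in> full \<Gamma> \<Longrightarrow> cc (g \<otimes>\<^bsub>tfg \<Gamma>\<^esub> h) z = cc g (h z) + cc h z"
  using cocycle_mult[OF \<Gamma>] H_tfg by blast

lemma H_apply: "g \<in> H \<Longrightarrow> z \<in> full \<Gamma> \<Longrightarrow> g z = shift (cc g z) z"
  using cocycle_props(2) H_tfg by blast

definition move :: "((int \<Rightarrow> 'a) \<Rightarrow> (int \<Rightarrow> 'a)) \<Rightarrow> (int \<Rightarrow> 'c) \<Rightarrow> (int \<Rightarrow> 'c)" where
  "move g = (\<lambda>x\<in>full \<Sigma>. Tpow (cc g (zcfg x)) x)"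

lemma move_full [simp]: "x \<in> full \<Sigma> \<Longrightarrow> move g x \<in> full \<Sigma>"
  by (simp add: move_def)

text \<open>\<open>move g\<close> takes as many steps as \<open>g\<close> shifts
  \<open>zcfg x\<close>. This equivariance brings the cocycle identity to bear on
  \<open>move\<close>, and later recovers \<open>g\<close> from its image.\<close>

lemma zcfg_move: "g \<in> H \<Longrightarrow> x \<in> full \<Sigma> \<Longrightarrow> zcfg (move g x) = g (zcfg x)"
  by (simp add: move_def cfg_Tpow H_apply)

lemma move_mult:
  assumes "g \<in> H" "h \<in> H" "x \<in> full \<Sigma>"
  shows "move (g \<otimes>\<^bsub>tfg \<Gamma>\<^esub> h) x = move g (move h x)"
proof -
  have "move g (move h x) = Tpow (cc g (zcfg (move h x))) (move h x)"
    using assms by (simp add: move_def)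
  also have "\<dots> = Tpow (cc g (h (zcfg x)) + cc h (zcfg x)) x"
    using assms by (simp only: zcfg_move) (simp add: move_def Tpow_add)
  finally show ?thesis using assms by (simp add: move_def cc_mult)
qed

lemma move_one: "x \<in> full \<Sigma> \<Longrightarrow> move \<one>\<^bsub>tfg \<Gamma>\<^esub> x = x"
  by (simp add: move_def cocycle_one[OF \<Gamma>] Tpow_0)

text \<open>Each fixed power has a continuous cocycle, and a locally constant exponent selects among
  them.\<close>

lemma Tpow_by_cocycle:
  assumes "local_const \<Sigma> k"
  shows "local_const \<Sigma> (\<lambda>x. cocycle \<Sigma> (Tpow (k x)) x)"
  using assms cocycle_props(1)[OF Tpow_closed] by (rule local_const_bind)

lemma move_closed:
  assumes "g \<in> H"
  shows "move g \<in> carrier (tfg \<Sigma>)"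
proof -
  have *: "local_const \<Sigma> (\<lambda>x. cocycle \<Sigma> (Tpow (cc g (zcfg x))) x)"
    "\<And>x. x \<in> full \<Sigma> \<Longrightarrow> move g x = shift (cocycle \<Sigma> (Tpow (cc g (zcfg x))) x) x" if "g \<in> H" for g
    using Tpow_by_cocycle[OF cc_lc[OF that]] cocycle_props(2)[OF Tpow_closed] by (auto simp: move_def)
  have inv: "inv\<^bsub>G\<^esub> g \<in> H" using G.inv_closed assms by simp
  have "move (inv\<^bsub>G\<^esub> g) (move g x) = x" "move g (move (inv\<^bsub>G\<^esub> g) x) = x" if "x \<in> full \<Sigma>" for x
    using G.l_inv[of g] G.r_inv[of g] assms inv that by (simp_all add: move_mult[symmetric] move_one)
  moreover have "move g \<in> extensional (full \<Sigma>)"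
    unfolding move_def by (rule restrict_extensional)
  ultimately show ?thesis
    by (intro tfgI[OF _ *[OF assms] *[OF inv]])
qed

section \<open>The action of the base group of the wreath product\<close>

abbreviation supp :: "(((int \<Rightarrow> 'a) \<Rightarrow> (int \<Rightarrow> 'a)) \<Rightarrow> 'b) \<Rightarrow> _" where
  "supp \<beta> \<equiv> {k \<in> H. \<beta> k \<noteq> \<one>\<^bsub>A\<^esub>}"

text \<open>The element of \<open>A\<close> that \<open>\<beta>\<close> applies at \<open>x\<close>.
  The cocycle is taken at the inverse of \<open>k\<close>, which is what makes left translation of
  \<open>\<beta>\<close> correspond to moving \<open>x\<close>.\<close>

definition act :: "(((int \<Rightarrow> 'a) \<Rightarrow> (int \<Rightarrow> 'a)) \<Rightarrow> 'b) \<Rightarrow> (int \<Rightarrow> 'c) \<Rightarrow> 'b" where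
  "act \<beta> x = finprod A (\<lambda>k. ecfg x (cc (inv\<^bsub>G\<^esub> k) (zcfg x)) (\<beta> k)) (supp \<beta>)"

text \<open>Endomorphisms fix the unit, so factors off the support are trivial. This lets functions
  with different supports be compared over a common index set.\<close>

lemma act_superset:
  assumes "x \<in> full \<Sigma>" "\<beta> \<in> H \<rightarrow> carrier A" "finite F" "supp \<beta> \<subseteq> F" "F \<subseteq> H"
  shows "act \<beta> x = finprod A (\<lambda>k. ecfg x (cc (inv\<^bsub>G\<^esub> k) (zcfg x)) (\<beta> k)) F"
  unfolding act_def
proof (rule A.finprod_mono_neutral_cong_left[OF assms(3,4)])
  show "ecfg x (cc (inv\<^bsub>G\<^esub> k) (zcfg x)) (\<beta> k) = \<one>\<^bsub>A\<^esub>" if "k \<in> F - supp \<beta>" for k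
    using that assms(5) hom_one[OF ecfg_in[OF assms(1)] A.is_group A.is_group] by auto
qed (use assms in \<open>auto simp: Pi_iff\<close>)

lemma act_closed [simp]: "x \<in> full \<Sigma> \<Longrightarrow> \<beta> \<in> H \<rightarrow> carrier A \<Longrightarrow> act \<beta> x \<in> carrier A"
  unfolding act_def by (rule A.finprod_closed) (auto simp: Pi_iff)

lemma act_mult:
  assumes x: "x \<in> full \<Sigma>" and b: "\<beta> \<in> H \<rightarrow> carrier A" "\<beta>' \<in> H \<rightarrow> carrier A"
    and fin: "finite (supp \<beta>)" "finite (supp \<beta>')"
    and \<delta>: "\<And>k. k \<in> H \<Longrightarrow> \<delta> k = \<beta> k \<otimes>\<^bsub>A\<^esub> \<beta>' k"
  shows "act \<delta> x = act \<beta> x \<otimes>\<^bsub>A\<^esub> act \<beta>' x"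
proof -
  let ?F = "supp \<beta> \<union> supp \<beta>'" and ?e = "\<lambda>k. ecfg x (cc (inv\<^bsub>G\<^esub> k) (zcfg x))"
  have "act \<delta> x = finprod A (\<lambda>k. ?e k (\<delta> k)) ?F"
    using b fin x by (intro act_superset) (auto simp: \<delta> Pi_iff)
  also have "\<dots> = finprod A (\<lambda>k. ?e k (\<beta> k) \<otimes>\<^bsub>A\<^esub> ?e k (\<beta>' k)) ?F"
    using b x by (intro A.finprod_cong') (auto simp: \<delta> hom_mult[OF ecfg_in] Pi_iff)
  also have "\<dots> = finprod A (\<lambda>k. ?e k (\<beta> k)) ?F \<otimes>\<^bsub>A\<^esub> finprod A (\<lambda>k. ?e k (\<beta>' k)) ?F"
    using b x by (intro A.finprod_multf) (auto simp: Pi_iff)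
  also have "\<dots> = act \<beta> x \<otimes>\<^bsub>A\<^esub> act \<beta>' x"
    using b fin x act_superset[of x \<beta> ?F] act_superset[of x \<beta>' ?F] by auto
  finally show ?thesis .
qed

lemma act_\<alpha>:
  "x \<in> full \<Sigma> \<Longrightarrow> a \<in> carrier A \<Longrightarrow> act \<beta> (\<alpha> a x) = act \<beta> x"
  by (simp add: act_def cfg_\<alpha>)

text \<open>Reindex by \<open>k = g l\<close> and let \<open>z = zcfg x\<close>. The cocycle of the
  inverse of \<open>g l\<close> at \<open>g z\<close> is that of the inverse of \<open>l\<close> at
  \<open>z\<close>, minus \<open>cc g z\<close>; the readings at \<open>move g x\<close> are shifted
  by exactly \<open>cc g z\<close>, which cancels the difference.\<close>

lemma act_translate:
  assumes g: "g \<in> H" and x: "x \<in> full \<Sigma>" and b: "\<beta> \<in> H \<rightarrow> carrier A"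
    and \<delta>: "\<And>k. k \<in> H \<Longrightarrow> \<delta> k = \<beta> (inv\<^bsub>G\<^esub> g \<otimes>\<^bsub>tfg \<Gamma>\<^esub> k)"
  shows "act \<delta> (move g x) = act \<beta> x"
proof -
  let ?m = "\<lambda>k. g \<otimes>\<^bsub>tfg \<Gamma>\<^esub> k" and ?y = "move g x"
  have H_mult: "k \<in> H \<Longrightarrow> l \<in> H \<Longrightarrow> k \<otimes>\<^bsub>tfg \<Gamma>\<^esub> l \<in> H" for k l
    using G.m_closed by simp
  have H_inv: "k \<in> H \<Longrightarrow> inv\<^bsub>G\<^esub> k \<in> H" for k
    using G.inv_closed by simp
  have cancel: "inv\<^bsub>G\<^esub> g \<otimes>\<^bsub>tfg \<Gamma>\<^esub> (g \<otimes>\<^bsub>tfg \<Gamma>\<^esub> k) = k" "g \<otimes>\<^bsub>tfg \<Gamma>\<^esub> (inv\<^bsub>G\<^esub> g \<otimes>\<^bsub>tfg \<Gamma>\<^esub> k) = k"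
    if "k \<in> H" for k
    using that g G.inv_solve_left[of k g "g \<otimes>\<^bsub>G\<^esub> k"] G.inv_solve_left[of "inv\<^bsub>G\<^esub> g \<otimes>\<^bsub>G\<^esub> k" g k] H_mult H_inv
    by (auto simp del: G.m_closed)
  have supp: "supp \<delta> = ?m ` supp \<beta>"
  proof (intro equalityI subsetI)
    fix k assume "k \<in> supp \<delta>"
    then show "k \<in> ?m ` supp \<beta>"
      using g by (intro image_eqI[of _ _ "inv\<^bsub>G\<^esub> g \<otimes>\<^bsub>tfg \<Gamma>\<^esub> k"]) (auto simp: cancel \<delta> H_mult H_inv)
  qed (use g in \<open>auto simp: \<delta> cancel H_mult\<close>)
  have inj: "inj_on ?m (supp \<beta>)"
    by (rule inj_on_inverseI[where g = "\<lambda>k. inv\<^bsub>G\<^esub> g \<otimes>\<^bsub>tfg \<Gamma>\<^esub> k"]) (simp add: cancel)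
  have y: "?y \<in> full \<Sigma>" using x by simp
  have summand: "ecfg ?y (cc (inv\<^bsub>G\<^esub> (?m k)) (zcfg ?y)) (\<delta> (?m k)) = ecfg x (cc (inv\<^bsub>G\<^esub> k) (zcfg x)) (\<beta> k)"
    if k: "k \<in> H" for k
  proof -
    have gz: "(inv\<^bsub>G\<^esub> g) (g (zcfg x)) = zcfg x"
      using G.l_inv[of g] g x tfg_mult[of "zcfg x" \<Gamma> "inv\<^bsub>G\<^esub> g" g] by (simp add: tfg_one)
    have "inv\<^bsub>G\<^esub> (?m k) = inv\<^bsub>G\<^esub> k \<otimes>\<^bsub>tfg \<Gamma>\<^esub> inv\<^bsub>G\<^esub> g"
      using G.inv_mult_group[of g k] g k by simp
    then have "cc (inv\<^bsub>G\<^esub> (?m k)) (zcfg ?y) = cc (inv\<^bsub>G\<^esub> k) (zcfg x) + cc (inv\<^bsub>G\<^esub> g) (g (zcfg x))"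
      using g k x tfg_maps[OF H_tfg[OF g]] by (simp add: cc_mult H_inv zcfg_move gz)
    moreover have "cc (inv\<^bsub>G\<^esub> g) (g (zcfg x)) + cc g (zcfg x) = 0"
      using cc_mult[of "inv\<^bsub>G\<^esub> g" g "zcfg x"] G.l_inv[of g] g x by (simp add: H_inv cocycle_one[OF \<Gamma>])
    ultimately have "cc (inv\<^bsub>G\<^esub> (?m k)) (zcfg ?y) + cc g (zcfg x) = cc (inv\<^bsub>G\<^esub> k) (zcfg x)" by simp
    moreover have "ecfg ?y = shift (cc g (zcfg x)) (ecfg x)"
      using x by (simp add: move_def cfg_Tpow)
    ultimately show ?thesis using k g by (simp add: shift_apply \<delta> cancel H_mult)
  qed
  have \<delta>': "\<delta> k \<in> carrier A" if "k \<in> H" for k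
    using b that g by (auto simp: \<delta> H_mult H_inv Pi_iff)
  have "act \<delta> ?y = finprod A (\<lambda>k. ecfg ?y (cc (inv\<^bsub>G\<^esub> (?m k)) (zcfg ?y)) (\<delta> (?m k))) (supp \<beta>)"
    unfolding act_def supp using y g \<delta>' by (intro A.finprod_reindex inj) (auto simp: H_mult)
  also have "\<dots> = act \<beta> x"
    unfolding act_def using b x by (intro A.finprod_cong') (auto simp: summand Pi_iff)
  finally show ?thesis .
qed

text \<open>By finiteness of the support, the value is computed from a finite bundle of locally
  constant factors.\<close>

lemma act_lc:
  assumes "finite (supp \<beta>)" "\<beta> \<in> H \<rightarrow> carrier A"
  shows "local_const \<Sigma> (act \<beta>)"
proof -
  let ?t = "\<lambda>k x. ecfg x (cc (inv\<^bsub>G\<^esub> k) (zcfg x)) (\<beta> k)"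
  have "local_const \<Sigma> (?t k)" if "k \<in> supp \<beta>" for k
  proof -
    have "local_const \<Sigma> (\<lambda>x. ecfg x (cc (inv\<^bsub>G\<^esub> k) (zcfg x)))"
      using that G.inv_closed[of k] by (intro local_const_bind[OF cc_lc ecfg_lc]) simp
    then show ?thesis by (rule local_const_comp)
  qed
  then have "local_const \<Sigma> (\<lambda>x. finprod A (restrict (\<lambda>k. ?t k x) (supp \<beta>)) (supp \<beta>))"
    using local_const_comp[OF local_const_finite[OF assms(1), of \<Sigma> ?t], of "\<lambda>r. finprod A r (supp \<beta>)"] by simp
  then show ?thesis
    by (rule local_const_cong) (use assms in \<open>auto simp: act_def Pi_iff intro!: A.finprod_cong'\<close>)
qed

definition lamp :: "(((int \<Rightarrow> 'a) \<Rightarrow> (int \<Rightarrow> 'a)) \<Rightarrow> 'b) \<Rightarrow> (int \<Rightarrow> 'c) \<Rightarrow> (int \<Rightarrow> 'c)" where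
  "lamp \<beta> = (\<lambda>x\<in>full \<Sigma>. \<alpha> (act \<beta> x) x)"

lemma lamp_full [simp]: "x \<in> full \<Sigma> \<Longrightarrow> \<beta> \<in> H \<rightarrow> carrier A \<Longrightarrow> lamp \<beta> x \<in> full \<Sigma>"
  by (simp add: lamp_def)

text \<open>The inner lamp moves \<open>x\<close> by \<open>\<alpha>\<close> only, which leaves the
  readings and hence the amount applied by the outer lamp unchanged.\<close>

lemma lamp_mult:
  assumes "x \<in> full \<Sigma>" "\<beta> \<in> H \<rightarrow> carrier A" "\<beta>' \<in> H \<rightarrow> carrier A"
    "finite (supp \<beta>)" "finite (supp \<beta>')"
    "\<And>k. k \<in> H \<Longrightarrow> \<delta> k = \<beta> k \<otimes>\<^bsub>A\<^esub> \<beta>' k"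
  shows "lamp \<delta> x = lamp \<beta> (lamp \<beta>' x)"
  using assms act_mult[OF assms] by (simp add: lamp_def act_\<alpha> \<alpha>_mult)

lemma lamp_one:
  assumes "x \<in> full \<Sigma>" "\<And>k. k \<in> H \<Longrightarrow> \<beta> k = \<one>\<^bsub>A\<^esub>"
  shows "lamp \<beta> x = x"
proof -
  have "supp \<beta> = {}" using assms by auto
  then show ?thesis
    using assms(1) unfolding lamp_def act_def by (simp only: A.finprod_empty) (simp add: \<alpha>_one)
qed

lemma lamp_inverse:
  assumes "x \<in> full \<Sigma>" "\<beta> \<in> H \<rightarrow> carrier A" "finite (supp \<beta>)"
  shows "lamp (\<lambda>k. inv\<^bsub>A\<^esub> \<beta> k) (lamp \<beta> x) = x" "lamp \<beta> (lamp (\<lambda>k. inv\<^bsub>A\<^esub> \<beta> k) x) = x"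
proof -
  have i: "(\<lambda>k. inv\<^bsub>A\<^esub> \<beta> k) \<in> H \<rightarrow> carrier A" "finite (supp (\<lambda>k. inv\<^bsub>A\<^esub> \<beta> k))"
    using assms by (auto simp: Pi_iff elim: rev_finite_subset)
  show "lamp (\<lambda>k. inv\<^bsub>A\<^esub> \<beta> k) (lamp \<beta> x) = x"
    using lamp_mult[OF assms(1) i(1) assms(2) i(2) assms(3), of "\<lambda>_. \<one>\<^bsub>A\<^esub>"] assms
    by (simp add: Pi_iff lamp_one)
  show "lamp \<beta> (lamp (\<lambda>k. inv\<^bsub>A\<^esub> \<beta> k) x) = x"
    using lamp_mult[OF assms(1,2) i(1) assms(3) i(2), of "\<lambda>_. \<one>\<^bsub>A\<^esub>"] assms
    by (simp add: Pi_iff lamp_one)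
qed

lemma lamp_closed:
  assumes "\<beta> \<in> H \<rightarrow> carrier A" "finite (supp \<beta>)"
  shows "lamp \<beta> \<in> carrier (tfg \<Sigma>)"
proof -
  \<comment> \<open>\<open>local_const_bind\<close> wants a locally constant function for every
    \<open>a\<close> of the type, hence the dummy 0 off the carrier.\<close>
  let ?c = "\<lambda>a. if a \<in> carrier A then cocycle \<Sigma> (\<alpha> a) else (\<lambda>_. 0)"
  have c: "local_const \<Sigma> (?c a)" for a
    using cocycle_props(1)[OF \<alpha>_closed] by simp
  have *: "local_const \<Sigma> (\<lambda>x. ?c (act \<beta> x) x)"
    "\<And>x. x \<in> full \<Sigma> \<Longrightarrow> lamp \<beta> x = shift (?c (act \<beta> x) x) x"
    if "\<beta> \<in> H \<rightarrow> carrier A" "finite (supp \<beta>)" for \<beta>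
  proof -
    show "local_const \<Sigma> (\<lambda>x. ?c (act \<beta> x) x)"
      by (rule local_const_bind[OF act_lc[OF that(2,1)] c])
    show "lamp \<beta> x = shift (?c (act \<beta> x) x) x" if "x \<in> full \<Sigma>" for x
      using cocycle_props(2)[OF \<alpha>_closed, of "act \<beta> x" x] that \<open>\<beta> \<in> H \<rightarrow> carrier A\<close>
      by (simp add: lamp_def)
  qed
  have i: "(\<lambda>k. inv\<^bsub>A\<^esub> \<beta> k) \<in> H \<rightarrow> carrier A" "finite (supp (\<lambda>k. inv\<^bsub>A\<^esub> \<beta> k))"
    using assms by (auto simp: Pi_iff elim: rev_finite_subset)
  have "lamp \<beta> \<in> extensional (full \<Sigma>)"
    unfolding lamp_def by (rule restrict_extensional)
  from tfgI[OF this *[OF assms] *[OF i] lamp_inverse[OF _ assms]]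
  show ?thesis .
qed

text \<open>The conjugation relation of the semidirect product. A lamp does not alter the number of
  steps and \<open>\<alpha>\<close> commutes with them; \<open>act_translate\<close> then rewrites
  the amount at the new point.\<close>

lemma move_lamp:
  assumes g: "g \<in> H" and x: "x \<in> full \<Sigma>" and b: "\<beta> \<in> H \<rightarrow> carrier A"
    and \<delta>: "\<And>k. k \<in> H \<Longrightarrow> \<delta> k = \<beta> (inv\<^bsub>G\<^esub> g \<otimes>\<^bsub>tfg \<Gamma>\<^esub> k)"
  shows "move g (lamp \<beta> x) = lamp \<delta> (move g x)"
proof -
  have a: "act \<beta> x \<in> carrier A" using x b by simp
  have "move g (lamp \<beta> x) = \<alpha> (act \<beta> x) (move g x)"
    using x a by (simp add: move_def lamp_def cfg_\<alpha> Tpow_\<alpha>)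
  also have "\<dots> = lamp \<delta> (move g x)"
    using x act_translate[OF assms] by (simp add: lamp_def)
  finally show ?thesis .
qed

section \<open>The homomorphism from the wreath product and its injectivity\<close>

definition emb where
  "emb = (\<lambda>(\<beta>, g). lamp \<beta> \<otimes>\<^bsub>tfg \<Sigma>\<^esub> move g)"

lemma wreath_carrier:
  "(\<beta>, g) \<in> carrier (wreath A G) \<longleftrightarrow>
     \<beta> \<in> extensional H \<and> \<beta> \<in> H \<rightarrow> carrier A \<and> finite (supp \<beta>) \<and> g \<in> H"
  by (simp add: wreath_def)

lemma translate_supp:
  assumes g: "g \<in> H" and b: "\<beta> \<in> H \<rightarrow> carrier A" "finite (supp \<beta>)"
  defines "\<delta> \<equiv> \<lambda>k. \<beta> (inv\<^bsub>G\<^esub> g \<otimes>\<^bsub>tfg \<Gamma>\<^esub> k)"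
  shows "\<delta> \<in> H \<rightarrow> carrier A" "finite (supp \<delta>)"
proof -
  have m: "inv\<^bsub>G\<^esub> g \<otimes>\<^bsub>tfg \<Gamma>\<^esub> k \<in> H" if "k \<in> H" for k
    using that g G.m_closed[OF G.inv_closed, of g k] by simp
  then show "\<delta> \<in> H \<rightarrow> carrier A" using b by (auto simp: \<delta>_def)
  have "inj_on (\<lambda>k. inv\<^bsub>G\<^esub> g \<otimes>\<^bsub>tfg \<Gamma>\<^esub> k) (supp \<delta>)"
    using G.inj_on_cmult[of "inv\<^bsub>G\<^esub> g"] g G.inv_closed[of g] by (auto elim: inj_on_subset)
  moreover have "finite ((\<lambda>k. inv\<^bsub>G\<^esub> g \<otimes>\<^bsub>tfg \<Gamma>\<^esub> k) ` supp \<delta>)"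
    by (rule finite_subset[OF _ b(2)]) (auto simp: \<delta>_def m)
  ultimately show "finite (supp \<delta>)" by (simp add: finite_image_iff)
qed

lemma emb_hom: "emb \<in> hom (wreath A G) (tfg \<Sigma>)"
proof (rule homI)
  fix u assume "u \<in> carrier (wreath A G)"
  then show "emb u \<in> carrier (tfg \<Sigma>)"
    by (cases u) (auto simp: emb_def wreath_carrier intro!: lamp_closed move_closed)
next
  fix u v assume u: "u \<in> carrier (wreath A G)" and v: "v \<in> carrier (wreath A G)"
  obtain \<beta> g where ug: "u = (\<beta>, g)" by fastforce
  obtain \<beta>' h where vh: "v = (\<beta>', h)" by fastforce
  have b: "\<beta> \<in> H \<rightarrow> carrier A" "finite (supp \<beta>)" "g \<in> H"
    and b': "\<beta>' \<in> H \<rightarrow> carrier A" "finite (supp \<beta>')" "h \<in> H"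
    using u v by (auto simp: ug vh wreath_carrier)
  define \<delta> where "\<delta> = (\<lambda>k. \<beta>' (inv\<^bsub>G\<^esub> g \<otimes>\<^bsub>tfg \<Gamma>\<^esub> k))"
  \<comment> \<open>Restricted to \<open>H\<close>, since base group elements of
    \<open>wreath\<close> are extensional.\<close>
  define \<rho> where "\<rho> = (\<lambda>k\<in>H. \<beta> k \<otimes>\<^bsub>A\<^esub> \<delta> k)"
  have \<delta>: "\<delta> \<in> H \<rightarrow> carrier A" "finite (supp \<delta>)"
    unfolding \<delta>_def using translate_supp[OF b(3) b'(1,2)] by auto
  have \<rho>: "\<rho> \<in> H \<rightarrow> carrier A" using b \<delta> by (auto simp: \<rho>_def Pi_iff)
  have \<rho>': "finite (supp \<rho>)"
    by (rule finite_subset[of _ "supp \<beta> \<union> supp \<delta>"]) (use b \<delta> in \<open>auto simp: \<rho>_def\<close>)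
  have gh: "g \<otimes>\<^bsub>tfg \<Gamma>\<^esub> h \<in> H" using G.m_closed[of g h] b b' by simp
  have uv: "u \<otimes>\<^bsub>wreath A G\<^esub> v = (\<rho>, g \<otimes>\<^bsub>tfg \<Gamma>\<^esub> h)"
    by (simp add: wreath_def ug vh \<rho>_def \<delta>_def)
  have "(lamp \<rho> \<otimes>\<^bsub>tfg \<Sigma>\<^esub> move (g \<otimes>\<^bsub>tfg \<Gamma>\<^esub> h)) =
    (lamp \<beta> \<otimes>\<^bsub>tfg \<Sigma>\<^esub> move g) \<otimes>\<^bsub>tfg \<Sigma>\<^esub> (lamp \<beta>' \<otimes>\<^bsub>tfg \<Sigma>\<^esub> move h)"
  proof (rule tfg_eqI[of _ \<Sigma>])
    fix x assume x: "x \<in> full \<Sigma>"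
    \<comment> \<open>Pulling \<open>lamp \<beta>'\<close> in front of \<open>move g\<close>
      replaces it by its translate; the two lamps then merge.\<close>
    have "lamp \<beta> (move g (lamp \<beta>' (move h x))) = lamp \<beta> (lamp \<delta> (move g (move h x)))"
      using move_lamp[OF b(3) _ b'(1), of "move h x" \<delta>] x by (simp add: \<delta>_def)
    also have "\<dots> = lamp \<rho> (move g (move h x))"
      using lamp_mult[OF _ b(1) \<delta>(1) b(2) \<delta>(2), of "move g (move h x)" \<rho>] x by (simp add: \<rho>_def)
    finally show "(lamp \<rho> \<otimes>\<^bsub>tfg \<Sigma>\<^esub> move (g \<otimes>\<^bsub>tfg \<Gamma>\<^esub> h)) x =
      ((lamp \<beta> \<otimes>\<^bsub>tfg \<Sigma>\<^esub> move g) \<otimes>\<^bsub>tfg \<Sigma>\<^esub> (lamp \<beta>' \<otimes>\<^bsub>tfg \<Sigma>\<^esub> move h)) x"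
      using x b b' by (simp add: tfg_mult move_mult)
  qed (use b b' \<rho> \<rho>' gh in \<open>auto intro!: TS.m_closed lamp_closed move_closed\<close>)
  then show "emb (u \<otimes>\<^bsub>wreath A G\<^esub> v) = emb u \<otimes>\<^bsub>tfg \<Sigma>\<^esub> emb v"
    by (simp only: uv) (simp add: emb_def ug vh)
qed

text \<open>First \<open>g\<close> is recovered from its effect on \<open>zcfg\<close>, which lamps
  do not change. The quotient of the two base elements then acts trivially everywhere, whereas
  move-faithfulness and \<open>rich\<close> would provide a point where a nontrivial one does
  not.\<close>

lemma emb_inj:
  assumes rich: "\<And>z \<gamma>. z \<in> full \<Gamma> \<Longrightarrow> (\<And>n. \<gamma> n \<in> hom A A) \<Longrightarrow>
      \<exists>x\<in>full \<Sigma>. zcfg x = z \<and> (\<forall>n. \<forall>a\<in>carrier A. ecfg x n a = \<gamma> n a) \<and>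
        (\<forall>a\<in>carrier A. \<alpha> a x = x \<longrightarrow> a = \<one>\<^bsub>A\<^esub>)"
    and faithful: "move_faithful A \<Gamma> H"
  shows "inj_on emb (carrier (wreath A G))"
proof (rule inj_onI)
  fix u v assume u: "u \<in> carrier (wreath A G)" and v: "v \<in> carrier (wreath A G)"
    and eq: "emb u = emb v"
  obtain \<beta> g where ug: "u = (\<beta>, g)" by fastforce
  obtain \<beta>' h where vh: "v = (\<beta>', h)" by fastforce
  have b: "\<beta> \<in> H \<rightarrow> carrier A" "finite (supp \<beta>)" "g \<in> H" "\<beta> \<in> extensional H"
    and b': "\<beta>' \<in> H \<rightarrow> carrier A" "finite (supp \<beta>')" "h \<in> H" "\<beta>' \<in> extensional H"
    using u v by (auto simp: ug vh wreath_carrier)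
  have eqx: "lamp \<beta> (move g x) = lamp \<beta>' (move h x)" if "x \<in> full \<Sigma>" for x
    using fun_cong[OF eq, of x] that by (simp add: emb_def ug vh tfg_mult)
  have gh: "g = h"
  proof (rule tfg_eqI[of _ \<Gamma>])
    fix z assume z: "z \<in> full \<Gamma>"
    \<comment> \<open>Only \<open>z\<close> matters here; the identity is an arbitrary choice of
      endomorphisms.\<close>
    have "id \<in> hom A A" by (auto simp: hom_def)
    then obtain x where x: "x \<in> full \<Sigma>" "zcfg x = z" using rich[OF z, of "\<lambda>_. id"] by auto
    have "zcfg (lamp \<beta> (move g x)) = g z" "zcfg (lamp \<beta>' (move h x)) = h z"
      using x b b' by (simp_all add: lamp_def cfg_\<alpha> zcfg_move)
    then show "g z = h z" using eqx[OF x(1)] by simp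
  qed (use b b' H_tfg in auto)
  have lamp_eq: "lamp \<beta> y = lamp \<beta>' y" if y: "y \<in> full \<Sigma>" for y
  proof -
    have i: "inv\<^bsub>G\<^esub> g \<in> H" using b G.inv_closed by simp
    have "move g (move (inv\<^bsub>G\<^esub> g) y) = y"
      using move_mult[OF b(3) i y] G.r_inv[of g] b y by (simp add: move_one)
    then show ?thesis using eqx[of "move (inv\<^bsub>G\<^esub> g) y"] y gh by simp
  qed
  define \<delta> where "\<delta> = (\<lambda>k. \<beta> k \<otimes>\<^bsub>A\<^esub> inv\<^bsub>A\<^esub> \<beta>' k)"
  have i: "(\<lambda>k. inv\<^bsub>A\<^esub> \<beta>' k) \<in> H \<rightarrow> carrier A" "finite (supp (\<lambda>k. inv\<^bsub>A\<^esub> \<beta>' k))"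
    using b' by (auto simp: Pi_iff elim: rev_finite_subset)
  have \<delta>: "\<delta> \<in> H \<rightarrow> carrier A" using b i by (auto simp: \<delta>_def Pi_iff)
  have \<delta>': "finite (supp \<delta>)"
    by (rule finite_subset[of _ "supp \<beta> \<union> supp \<beta>'"]) (use b b' in \<open>auto simp: \<delta>_def\<close>)
  have lamp_\<delta>: "lamp \<delta> x = x" if x: "x \<in> full \<Sigma>" for x
  proof -
    have "lamp \<delta> x = lamp \<beta> (lamp (\<lambda>k. inv\<^bsub>A\<^esub> \<beta>' k) x)"
      by (rule lamp_mult[OF x b(1) i(1) b(2) i(2)]) (simp add: \<delta>_def)
    also have "\<dots> = lamp \<beta>' (lamp (\<lambda>k. inv\<^bsub>A\<^esub> \<beta>' k) x)" using lamp_eq x i by simp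
    finally show ?thesis using lamp_inverse(2)[OF x b'(1,2)] by simp
  qed
  have "supp \<delta> = {}"
  proof (rule ccontr)
    assume ne: "supp \<delta> \<noteq> {}"
    have H_inv: "k \<in> H \<Longrightarrow> inv\<^bsub>G\<^esub> k \<in> H" for k using G.inv_closed by simp
    have ii: "k \<in> H \<Longrightarrow> inv\<^bsub>G\<^esub> (inv\<^bsub>G\<^esub> k) = k" for k using G.inv_inv by simp
    \<comment> \<open>\<open>act\<close> evaluates the cocycle at inverses while
      \<open>move_faithful\<close> evaluates it at the elements themselves, so the hypothesis is
      applied to \<open>\<delta>\<close> composed with inversion.\<close>
    define \<epsilon> where "\<epsilon> = (\<lambda>k. \<delta> (inv\<^bsub>G\<^esub> k))"
    have \<epsilon>_eq: "\<delta> (inv\<^bsub>G\<^esub> k) = \<epsilon> k" for k by (simp add: \<epsilon>_def)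
    have \<epsilon>: "\<epsilon> \<in> H \<rightarrow> carrier A" using \<delta> H_inv by (auto simp: \<epsilon>_def)
    have supp: "supp \<delta> = (\<lambda>k. inv\<^bsub>G\<^esub> k) ` supp \<epsilon>"
    proof (intro equalityI subsetI)
      fix k assume "k \<in> supp \<delta>"
      then show "k \<in> (\<lambda>k. inv\<^bsub>G\<^esub> k) ` supp \<epsilon>"
        by (intro image_eqI[of _ _ "inv\<^bsub>G\<^esub> k"]) (auto simp: \<epsilon>_def ii H_inv)
    qed (auto simp: \<epsilon>_def H_inv)
    have inj: "inj_on (\<lambda>k. inv\<^bsub>G\<^esub> k) (supp \<epsilon>)"
      by (rule inj_on_inverseI[where g = "\<lambda>k. inv\<^bsub>G\<^esub> k"]) (simp add: ii)
    have "finite (supp \<epsilon>)" "supp \<epsilon> \<noteq> {}"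
      using \<delta>' ne inj unfolding supp by (simp_all add: finite_image_iff)
    with faithful \<epsilon> obtain z \<gamma> where z: "z \<in> full \<Gamma>" and \<gamma>: "\<And>n. \<gamma> n \<in> hom A A"
      and ne1: "finprod A (\<lambda>k. \<gamma> (cc k z) (\<epsilon> k)) (supp \<epsilon>) \<noteq> \<one>\<^bsub>A\<^esub>"
      unfolding move_faithful_def by blast
    obtain x where x: "x \<in> full \<Sigma>" "zcfg x = z"
      and e: "\<And>n a. a \<in> carrier A \<Longrightarrow> ecfg x n a = \<gamma> n a"
      and free: "\<And>a. a \<in> carrier A \<Longrightarrow> \<alpha> a x = x \<Longrightarrow> a = \<one>\<^bsub>A\<^esub>"
      using rich[OF z, of \<gamma>] \<gamma> by blast
    have "act \<delta> x = finprod A (\<lambda>k. ecfg x (cc (inv\<^bsub>G\<^esub> (inv\<^bsub>G\<^esub> k)) (zcfg x)) (\<delta> (inv\<^bsub>G\<^esub> k))) (supp \<epsilon>)"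
      unfolding act_def supp using x \<delta> by (intro A.finprod_reindex inj) (auto simp: H_inv Pi_iff)
    also have "\<dots> = finprod A (\<lambda>k. \<gamma> (cc k z) (\<epsilon> k)) (supp \<epsilon>)"
      using x \<epsilon> hom_in_carrier[OF \<gamma>] by (intro A.finprod_cong') (auto simp: ii \<epsilon>_eq e Pi_iff)
    finally have "act \<delta> x \<noteq> \<one>\<^bsub>A\<^esub>" using ne1 by simp
    moreover have "act \<delta> x = \<one>\<^bsub>A\<^esub>"
      using lamp_\<delta>[OF x(1)] x \<delta> by (intro free) (simp_all add: lamp_def)
    ultimately show False by simp
  qed
  then have "\<beta> k = \<beta>' k" if "k \<in> H" for k
    using that A.inv_solve_right'[of "\<one>\<^bsub>A\<^esub>" "\<beta> k" "\<beta>' k"] b(1) b'(1) by (auto simp: \<delta>_def Pi_iff)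
  then have "\<beta> = \<beta>'" using b(4) b'(4) by (auto intro: extensionalityI)
  with gh show "u = v" by (simp add: ug vh)
qed

text \<open>Computes the whole orbit of a point along which \<open>T\<close> advances by a constant
  amount, as on an endless belt.\<close>

lemma Tpow_shift:
  assumes x: "x \<in> full \<Sigma>" and T: "\<And>i. T (shift (l * i) x) = shift (l * (i + 1)) x"
  shows "Tpow k x = shift (l * k) x"
proof -
  have nat: "Tpow (int n) (shift (l * i) x) = shift (l * (int n + i)) x" for n i
  proof (induction n)
    case 0
    then show ?case using x by (simp add: Tpow_0)
  next
    case (Suc n)
    have "Tpow (1 + int n) (shift (l * i) x) = T (Tpow (int n) (shift (l * i) x))"
      using x by (simp add: Tpow_add Tpow_1)
    also have "\<dots> = shift (l * ((int n + i) + 1)) x"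
      unfolding Suc by (rule T)
    finally show ?case by (simp add: algebra_simps)
  qed
  show ?thesis
  proof (cases k rule: int_cases2)
    case (nonneg n)
    then show ?thesis using nat[of n 0] by simp
  next
    case (nonpos n)
    \<comment> \<open>\<open>n\<close> steps forward from the claimed value lead to
      \<open>x\<close>; applying \<open>Tpow k\<close> undoes them.\<close>
    have "x = Tpow (int n) (shift (l * k) x)" using nat[of n k] nonpos by simp
    then have "Tpow k x = Tpow (k + int n) (shift (l * k) x)"
      using x by (simp add: Tpow_add)
    then show ?thesis using x nonpos by (simp add: Tpow_0)
  qed
qed

end

section \<open>Conveyor belts\<close>

text \<open>A cell is a word \<open>s1\<^sup>m s0 w s0\<close> of length \<open>2 * m\<close>. The first \<open>2 * N\<close> positions of a cell are the states of two
  parallel tracks, the upper one being shifted by \<open>N\<close>. Maximal runs of consecutive cells become conveyor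
  belts: the belt leads to the right on the lower track and to the left on the upper one.\<close>
locale cells =
  fixes \<Sigma> :: "'c set" and s0 s1 :: 'c and m N :: int
  assumes s: "s0 \<noteq> s1" and m: "2 \<le> m" and N: "0 < N" "N \<le> m"
begin

section \<open>Cells cannot overlap; the position of the origin in its cell\<close>

definition cell :: "(int \<Rightarrow> 'c) \<Rightarrow> bool" where
  "cell y \<longleftrightarrow> (\<forall>i\<in>{0..<m}. y i = s1) \<and> y m = s0 \<and> y (2 * m - 1) = s0"

text \<open>Otherwise the opening block of \<open>s1\<close> in the second cell covers offset
  \<open>m\<close> of the first (if \<open>k \<le> m\<close>) or its last offset
  \<open>2 * m - 1\<close> (if \<open>k > m\<close>), where \<open>s0\<close> stands.\<close>

lemma cell_overlap_pos:
  assumes "cell y" "cell (shift k y)" "k < 2 * m"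
  shows "k \<le> 0"
proof (rule ccontr)
  assume "\<not> k \<le> 0"
  then have k: "0 < k" by simp
  have *: "y (i + k) = s1" if "0 \<le> i" "i < m" for i
    using assms(2) that by (simp add: cell_def shift_apply)
  show False
  proof (cases "k \<le> m")
    case True
    then show False using *[of "m - k"] k assms(1) s by (simp add: cell_def)
  next
    case False
    then show False using *[of "2 * m - 1 - k"] assms s by (simp add: cell_def)
  qed
qed

lemma cell_overlap:
  assumes "cell y" "cell (shift k y)" "\<bar>k\<bar> < 2 * m"
  shows "k = 0"
proof -
  have "k \<le> 0" using assms by (intro cell_overlap_pos[of y k]) auto
  moreover have "- k \<le> 0" using assms by (intro cell_overlap_pos[of "shift k y" "- k"]) auto
  ultimately show ?thesis by simp
qed

lemma cell_lc: "local_const \<Sigma> cell"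
proof (rule local_const_window[of "2 * m"])
  fix x y :: "int \<Rightarrow> 'c" assume *: "\<And>i. \<bar>i\<bar> \<le> 2 * m \<Longrightarrow> y i = x i"
  have "y i = x i" if "i \<in> {0..<m}" for i using that by (intro *) auto
  moreover have "y m = x m" "y (2 * m - 1) = x (2 * m - 1)" using m by (auto intro!: *)
  ultimately show "cell y = cell x" by (simp add: cell_def)
qed

text \<open>The value \<open>- 1\<close> marks points that are not states; this includes offsets
  from \<open>2 * N\<close> on within a cell. Since \<open>N \<le> m\<close>,
  \<open>cell_overlap\<close> makes the offset unique.\<close>

definition pos :: "(int \<Rightarrow> 'c) \<Rightarrow> int" where
  "pos x = (if \<exists>j. 0 \<le> j \<and> j < 2 * N \<and> cell (shift (- j) x)
    then THE j. 0 \<le> j \<and> j < 2 * N \<and> cell (shift (- j) x) else - 1)"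

lemma pos_shift:
  assumes "cell y" "0 \<le> j" "j < 2 * N"
  shows "pos (shift j y) = j"
proof -
  have uniq: "i = j" if "0 \<le> i" "i < 2 * N" "cell (shift (j - i) y)" for i
  proof -
    have "\<bar>j - i\<bar> < 2 * m" using that assms N by linarith
    from cell_overlap[OF assms(1) that(3) this] show ?thesis by simp
  qed
  show ?thesis
    unfolding pos_def using assms
    by (auto intro!: the_equality exI[of _ j] intro: uniq)
qed

lemma pos_lc: "local_const \<Sigma> pos"
proof -
  have "local_const \<Sigma> (\<lambda>x. restrict (\<lambda>j. cell (shift (- j) x)) {0..<2 * N})"
    by (rule local_const_finite) (auto intro: local_const_shift[OF cell_lc])
  from local_const_comp[OF this, of "\<lambda>r. if \<exists>j. 0 \<le> j \<and> j < 2 * N \<and> r j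
    then THE j. 0 \<le> j \<and> j < 2 * N \<and> r j else - 1"]
  show ?thesis
    by (rule local_const_cong) (simp add: pos_def cong: conj_cong)
qed

section \<open>States on the two tracks, and maps that shift each state by its own amount\<close>

definition place :: "bool \<Rightarrow> int \<Rightarrow> (int \<Rightarrow> 'c) \<Rightarrow> (int \<Rightarrow> 'c)" where
  "place t j y = shift (if t then j + N else j) y"

definition valid :: "int \<Rightarrow> (int \<Rightarrow> 'c) \<Rightarrow> bool" where
  "valid j y \<longleftrightarrow> y \<in> full \<Sigma> \<and> cell y \<and> 0 \<le> j \<and> j < N"

lemma place_full: "valid j y \<Longrightarrow> place t j y \<in> full \<Sigma>"
  by (simp add: place_def valid_def)

lemma pos_place: "valid j y \<Longrightarrow> pos (place t j y) = (if t then j + N else j)"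
  by (auto simp: place_def valid_def intro!: pos_shift)

text \<open>Coordinates for all later computations: \<open>y\<close> is anchored at the start of the
  cell, \<open>t\<close> is the track (\<open>True\<close> for the upper one) and \<open>j\<close>
  the index of the element of \<open>A\<close>.\<close>

lemma place_cases:
  assumes "x \<in> full \<Sigma>"
  obtains "x \<in> full \<Sigma>" "pos x = - 1" | t j y where "x = place t j y" "valid j y"
proof (cases "\<exists>j. 0 \<le> j \<and> j < 2 * N \<and> cell (shift (- j) x)")
  case False
  then have "pos x = - 1" unfolding pos_def by (simp only: if_False)
  with assms show ?thesis by (rule that(1))
next
  case True
  then obtain j where j: "0 \<le> j" "j < 2 * N" "cell (shift (- j) x)" by blast
  define t where "t = (N \<le> j)"
  show ?thesis
    by (rule that(2)[of t "if t then j - N else j" "shift (- j) x"])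
      (use j assms in \<open>auto simp: t_def place_def valid_def\<close>)
qed

text \<open>The amount is a function of the anchored configuration and the offset of the origin, so
  it can depend on neighbouring cells; points that are not states stay fixed.\<close>

definition partial :: "((int \<Rightarrow> 'c) \<Rightarrow> int \<Rightarrow> int) \<Rightarrow> (int \<Rightarrow> 'c) \<Rightarrow> (int \<Rightarrow> 'c)" where
  "partial \<kappa> = (\<lambda>x\<in>full \<Sigma>. shift (if pos x < 0 then 0 else \<kappa> (shift (- pos x) x) (pos x)) x)"

lemma partial_none: "x \<in> full \<Sigma> \<Longrightarrow> pos x = - 1 \<Longrightarrow> partial \<kappa> x = x"
  by (simp add: partial_def)

lemma partial_place:
  assumes "valid j y"
  shows "partial \<kappa> (place t j y) =
    shift (\<kappa> y (if t then j + N else j) + (if t then j + N else j)) y"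
proof -
  have "\<not> pos (place t j y) < 0" using assms N by (simp add: pos_place valid_def)
  moreover have "shift (- pos (place t j y)) (place t j y) = y"
    using assms by (simp add: pos_place) (simp add: place_def)
  ultimately show ?thesis
    using assms unfolding partial_def by (simp add: place_full pos_place) (simp add: place_def)
qed

lemma partial_lc:
  assumes "\<And>j. local_const \<Sigma> (\<lambda>y. \<kappa> y j)"
  shows "local_const \<Sigma> (\<lambda>x. if pos x < 0 then 0 else \<kappa> (shift (- pos x) x) (pos x))"
proof (rule local_const_bind[where f = "\<lambda>p x. if p < 0 then 0 else \<kappa> (shift (- p) x) p", OF pos_lc])
  show "local_const \<Sigma> (\<lambda>x. if k < 0 then 0 else \<kappa> (shift (- k) x) k)" for k
    using local_const_shift[OF assms] by (cases "k < 0") simp_all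
qed

lemma partial_tfg:
  assumes "\<And>j. local_const \<Sigma> (\<lambda>y. \<kappa> y j)" "\<And>j. local_const \<Sigma> (\<lambda>y. \<kappa>' y j)"
    and "\<And>x. x \<in> full \<Sigma> \<Longrightarrow> partial \<kappa>' (partial \<kappa> x) = x"
    and "\<And>x. x \<in> full \<Sigma> \<Longrightarrow> partial \<kappa> (partial \<kappa>' x) = x"
  shows "partial \<kappa> \<in> carrier (tfg \<Sigma>)"
  by (rule tfgI[OF _ partial_lc[of \<kappa>, OF assms(1)] _ partial_lc[of \<kappa>', OF assms(2)] _ assms(3,4)])
    (simp_all add: partial_def del: restrict_apply, simp_all)

section \<open>The two involutions, the belt, and the rotation of states\<close>

definition flip :: "(int \<Rightarrow> 'c) \<Rightarrow> (int \<Rightarrow> 'c)" where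
  "flip = partial (\<lambda>y j. if j < N then N else - N)"

text \<open>From the lower track to the upper track of the right neighbour, and back. A state
  without such a neighbour is fixed, so that the \<open>flip\<close> that follows in
  \<open>belt\<close> makes the turn.\<close>

definition hop :: "(int \<Rightarrow> 'c) \<Rightarrow> (int \<Rightarrow> 'c)" where
  "hop = partial (\<lambda>y j. if j < N then if cell (shift (2 * m) y) then 2 * m + N else 0
     else if cell (shift (- 2 * m) y) then - 2 * m - N else 0)"

definition rot :: "(int \<Rightarrow> int) \<Rightarrow> (int \<Rightarrow> 'c) \<Rightarrow> (int \<Rightarrow> 'c)" where
  "rot \<tau> = partial (\<lambda>y j. if j < N then \<tau> j - j else \<tau> (j - N) - (j - N))"

text \<open>The neighbour to which track \<open>t\<close> leads; opposite tracks lead in opposite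
  directions.\<close>

definition side :: "bool \<Rightarrow> (int \<Rightarrow> 'c) \<Rightarrow> (int \<Rightarrow> 'c)" where
  "side t y = shift (if t then - 2 * m else 2 * m) y"

lemma side_side [simp]: "side (\<not> t) (side t y) = y"
  by (simp add: side_def)

lemma flip_place: "valid j y \<Longrightarrow> flip (place t j y) = place (\<not> t) j y"
  by (auto simp: flip_def partial_place) (auto simp: place_def valid_def add.commute)

lemma hop_place:
  "valid j y \<Longrightarrow> hop (place t j y) = (if cell (side t y) then place (\<not> t) j (side t y) else place t j y)"
  by (auto simp: hop_def partial_place) (auto simp: place_def valid_def side_def algebra_simps)

lemma rot_place: "valid j y \<Longrightarrow> rot \<tau> (place t j y) = place t (\<tau> j) y"
  by (auto simp: rot_def partial_place) (auto simp: place_def valid_def)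

lemma fixed_off_cells:
  assumes "x \<in> full \<Sigma>" "pos x = - 1"
  shows "flip x = x" "hop x = x" "rot \<tau> x = x"
  using assms by (simp_all add: flip_def hop_def rot_def partial_none)

lemma valid_side: "valid j y \<Longrightarrow> cell (side t y) \<Longrightarrow> valid j (side t y)"
  by (simp add: valid_def) (simp add: side_def)

lemma valid_rot: "valid j y \<Longrightarrow> \<tau> \<in> {0..<N} \<rightarrow> {0..<N} \<Longrightarrow> valid (\<tau> j) y"
  by (auto simp: valid_def Pi_iff)

lemma flip_flip: "x \<in> full \<Sigma> \<Longrightarrow> flip (flip x) = x"
  by (erule place_cases) (auto simp: fixed_off_cells flip_place)

text \<open>After crossing, the new track leads back to the old cell, so the same rule undoes the
  step.\<close>

lemma hop_hop: "x \<in> full \<Sigma> \<Longrightarrow> hop (hop x) = x"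
  by (erule place_cases) (auto simp: fixed_off_cells hop_place valid_side, simp_all add: valid_def)

lemma rot_rot:
  "x \<in> full \<Sigma> \<Longrightarrow> \<tau> \<in> {0..<N} \<rightarrow> {0..<N} \<Longrightarrow> rot \<tau>' (rot \<tau> x) = rot (\<lambda>j. \<tau>' (\<tau> j)) x"
  by (erule place_cases) (auto simp: fixed_off_cells rot_place valid_rot)

lemma rot_cong:
  "x \<in> full \<Sigma> \<Longrightarrow> (\<And>j. 0 \<le> j \<Longrightarrow> j < N \<Longrightarrow> \<tau> j = \<tau>' j) \<Longrightarrow> rot \<tau> x = rot \<tau>' x"
  by (erule place_cases) (simp_all add: fixed_off_cells rot_place valid_def)

lemma rot_id:
  "x \<in> full \<Sigma> \<Longrightarrow> (\<And>j. 0 \<le> j \<Longrightarrow> j < N \<Longrightarrow> \<tau> j = j) \<Longrightarrow> rot \<tau> x = x"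
  by (erule place_cases) (simp_all add: fixed_off_cells rot_place valid_def)

lemma flip_tfg: "flip \<in> carrier (tfg \<Sigma>)"
  unfolding flip_def
  by (rule partial_tfg[where \<kappa>' = "\<lambda>y j. if j < N then N else - N"])
    (simp_all add: flip_def[symmetric] flip_flip)

lemma hop_tfg: "hop \<in> carrier (tfg \<Sigma>)"
proof -
  let ?\<kappa> = "\<lambda>y j. if j < N then if cell (shift (2 * m) y) then 2 * m + N else 0
     else if cell (shift (- 2 * m) y) then - 2 * m - N else 0"
  have *: "local_const \<Sigma> (\<lambda>y. if cell (shift k y) then u else w)" for k u and w :: int
    by (rule local_const_comp[OF local_const_shift[OF cell_lc]])
  have lc: "local_const \<Sigma> (\<lambda>y. ?\<kappa> y j)" for j
    using *[of "2 * m" "2 * m + N" 0] *[of "- 2 * m" "- 2 * m - N" 0] by (cases "j < N") simp_all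
  show ?thesis
    unfolding hop_def by (rule partial_tfg[where \<kappa> = ?\<kappa> and \<kappa>' = ?\<kappa>, OF lc lc]) (simp_all only: hop_def[symmetric] hop_hop)
qed

lemma rot_tfg:
  assumes "\<tau> \<in> {0..<N} \<rightarrow> {0..<N}" "\<tau>' \<in> {0..<N} \<rightarrow> {0..<N}"
    and "\<And>j. 0 \<le> j \<Longrightarrow> j < N \<Longrightarrow> \<tau>' (\<tau> j) = j" "\<And>j. 0 \<le> j \<Longrightarrow> j < N \<Longrightarrow> \<tau> (\<tau>' j) = j"
  shows "rot \<tau> \<in> carrier (tfg \<Sigma>)"
  unfolding rot_def
proof (rule partial_tfg[where \<kappa>' = "\<lambda>y j. if j < N then \<tau>' j - j else \<tau>' (j - N) - (j - N)"];
    (unfold rot_def[symmetric])?)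
qed (use assms in \<open>simp_all add: rot_rot rot_id\<close>)

definition belt :: "(int \<Rightarrow> 'c) \<Rightarrow> (int \<Rightarrow> 'c)" where
  "belt = flip \<otimes>\<^bsub>tfg \<Sigma>\<^esub> hop"

lemma belt_tfg: "belt \<in> carrier (tfg \<Sigma>)"
  unfolding belt_def by (intro tfg_mult_closed flip_tfg hop_tfg)

text \<open>In the coordinates of \<open>place\<close>, a rotation changes only \<open>j\<close>,
  while \<open>flip\<close> and \<open>hop\<close> change only \<open>t\<close> and
  \<open>y\<close>.\<close>

lemma belt_rot:
  assumes "x \<in> full \<Sigma>" "\<tau> \<in> {0..<N} \<rightarrow> {0..<N}" "rot \<tau> x \<in> full \<Sigma>"
  shows "belt (rot \<tau> x) = rot \<tau> (belt x)"
proof -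
  have hop: "hop (rot \<tau> x) = rot \<tau> (hop x)" if "x \<in> full \<Sigma>" for x
    using that by (rule place_cases) (use assms that in \<open>auto simp: fixed_off_cells rot_place hop_place valid_rot valid_side\<close>)
  have flip: "flip (rot \<tau> x) = rot \<tau> (flip x)" if "x \<in> full \<Sigma>" for x
    using that by (rule place_cases) (use assms that in \<open>auto simp: fixed_off_cells rot_place flip_place valid_rot\<close>)
  show ?thesis
    using assms hop[of x] flip[of "hop x"] tfg_maps[OF hop_tfg] by (simp add: belt_def tfg_mult)
qed

lemma place_0: "place False 0 x = x"
  by (simp add: place_def)

lemma belt_cells:
  assumes "x \<in> full \<Sigma>" "cell x" "cell (shift (2 * m) x)"
  shows "belt x = shift (2 * m) x"
proof -
  have v: "valid 0 x" "cell (side False x)" "valid 0 (side False x)"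
    using assms N by (auto simp: valid_def side_def)
  have "flip (hop (place False 0 x)) = place False 0 (side False x)"
    using v by (simp add: hop_place flip_place)
  then show ?thesis using assms(1) by (simp add: place_0 belt_def tfg_mult side_def)
qed

section \<open>Labels: reading them off cells and writing them into cells\<close>

definition label :: "((int \<Rightarrow> 'c) \<Rightarrow> 'd) \<Rightarrow> 'd \<Rightarrow> (int \<Rightarrow> 'c) \<Rightarrow> 'd" where
  "label q d x = (if pos x < 0 then d else q (shift (- pos x) x))"

lemma label_lc:
  assumes "local_const \<Sigma> q"
  shows "local_const \<Sigma> (label q d)"
  unfolding label_def
proof (rule local_const_bind[where f = "\<lambda>p x. if p < 0 then d else q (shift (- p) x)", OF pos_lc])
  show "local_const \<Sigma> (\<lambda>x. if k < 0 then d else q (shift (- k) x))" for k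
    using local_const_shift[OF assms] by (cases "k < 0") simp_all
qed

lemma label_place:
  assumes "valid j y"
  shows "label q d (place t j y) = q y"
proof -
  have "\<not> pos (place t j y) < 0" using assms N by (simp add: pos_place valid_def)
  moreover have "shift (- pos (place t j y)) (place t j y) = y"
    using assms by (simp add: pos_place) (simp add: place_def)
  ultimately show ?thesis by (simp add: label_def)
qed

lemma label_cell: "x \<in> full \<Sigma> \<Longrightarrow> cell x \<Longrightarrow> label q d x = q x"
  using label_place[of 0 x q d False] N by (simp add: place_0 valid_def)

text \<open>The label is read at the start of the cell, and a rotation stays in the cell.\<close>

lemma label_rot:
  assumes "x \<in> full \<Sigma>" "\<tau> \<in> {0..<N} \<rightarrow> {0..<N}"
  shows "label q d (rot \<tau> x) = label q d x"
  using assms(1) by (rule place_cases) (use assms in \<open>auto simp: fixed_off_cells rot_place label_place valid_rot\<close>)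

text \<open>A point fixed by a nonzero shift shorter than a cell would have two overlapping
  cells.\<close>

lemma rot_free:
  assumes "x \<in> full \<Sigma>" "cell x" "\<tau> \<in> {0..<N} \<rightarrow> {0..<N}" "rot \<tau> x = x"
  shows "\<tau> 0 = 0"
proof -
  have v: "valid 0 x" using assms N by (simp add: valid_def)
  have "shift (\<tau> 0) x = x"
    using rot_place[OF v, of \<tau> False] assms(4) by (simp add: place_0) (simp add: place_def)
  moreover have "\<bar>\<tau> 0\<bar> < 2 * m" using assms(3) N by (auto dest!: Pi_mem[of _ _ _ 0])
  ultimately show ?thesis using cell_overlap[OF assms(2), of "\<tau> 0"] assms(2) by simp
qed

text \<open>The word \<open>w\<close> inside a cell stores an element of \<open>C\<close> in unary: it has a single \<open>s1\<close>, at offset \<open>h c\<close>.\<close>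
definition decode :: "('d \<Rightarrow> int) \<Rightarrow> 'd set \<Rightarrow> (int \<Rightarrow> 'c) \<Rightarrow> 'd" where
  "decode h C y = (SOME c. c \<in> C \<and> ((\<exists>c'\<in>C. y (m + 1 + h c') = s1) \<longrightarrow> y (m + 1 + h c) = s1))"

text \<open>The implication in \<open>decode\<close> keeps the choice inside \<open>C\<close> even
  when \<open>w\<close> is not a proper code word.\<close>

lemma decode_in: "C \<noteq> {} \<Longrightarrow> decode h C y \<in> C"
proof -
  assume "C \<noteq> {}"
  then have "\<exists>c. c \<in> C \<and> ((\<exists>c'\<in>C. y (m + 1 + h c') = s1) \<longrightarrow> y (m + 1 + h c) = s1)" by blast
  from someI_ex[OF this] show ?thesis by (simp add: decode_def)
qed

lemma decode_lc:
  assumes "h ` C \<subseteq> {0..<m - 2}"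
  shows "local_const \<Sigma> (decode h C)"
proof (rule local_const_window[of "2 * m"])
  fix x y :: "int \<Rightarrow> 'c" assume *: "\<And>i. \<bar>i\<bar> \<le> 2 * m \<Longrightarrow> y i = x i"
  have "y (m + 1 + h c) = x (m + 1 + h c)" if "c \<in> C" for c
    using assms that m by (intro *) force
  then show "decode h C y = decode h C x" unfolding decode_def by (metis (no_types, lifting))
qed

text \<open>A bi-infinite row of adjacent cells with \<open>c k\<close> stored in the
  \<open>k\<close>-th one. Offsets of \<open>h\<close> below \<open>m - 2\<close> keep the mark
  clear of the final \<open>s0\<close>.\<close>

definition encode :: "('d \<Rightarrow> int) \<Rightarrow> (int \<Rightarrow> 'd) \<Rightarrow> int \<Rightarrow> 'c" where
  "encode h c i = (let r = i mod (2 * m) in if r < m \<or> r = m + 1 + h (c (i div (2 * m))) then s1 else s0)"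

lemma encode_shift:
  "0 \<le> r \<Longrightarrow> r < 2 * m \<Longrightarrow> shift (2 * m * k) (encode h c) r = (if r < m \<or> r = m + 1 + h (c k) then s1 else s0)"
  using m by (simp add: shift_apply encode_def)

lemma cell_encode:
  assumes "\<And>k. c k \<in> C" "h ` C \<subseteq> {0..<m - 2}"
  shows "cell (shift (2 * m * k) (encode h c))"
proof -
  have "0 \<le> h (c k)" "h (c k) < m - 2" using assms by force+
  then show ?thesis using m s by (simp add: cell_def encode_shift)
qed

lemma decode_encode:
  assumes c: "\<And>k. c k \<in> C" and h: "h ` C \<subseteq> {0..<m - 2}" "inj_on h C"
  shows "decode h C (shift (2 * m * k) (encode h c)) = c k"
proof -
  have "shift (2 * m * k) (encode h c) (m + 1 + h d) = s1 \<longleftrightarrow> d = c k" if "d \<in> C" for d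
  proof -
    have "0 \<le> h d" "h d < m - 2" using h that by force+
    then show ?thesis using s m that c inj_onD[OF h(2)] by (subst encode_shift) auto
  qed
  then show ?thesis unfolding decode_def using c by (intro some_equality) auto
qed

end

section \<open>The embedding\<close>

lemma ex_bij_betw_int:
  assumes "finite S"
  obtains f :: "'s \<Rightarrow> int" where "bij_betw f S {0..<int (card S)}"
proof -
  obtain f where "bij_betw f S {0..<card S}" using ex_bij_betw_finite_nat[OF assms] by blast
  moreover have "bij_betw int {0..<card S} {0..<int (card S)}"
    by (simp add: bij_betw_def image_int_atLeastLessThan)
  ultimately show ?thesis using that bij_betw_trans by blast
qed

theorem mainTheorem12:
  fixes A :: "('b, 'x) monoid_scheme"
    and \<Gamma> :: "'a set"
    and H :: "((int \<Rightarrow> 'a) \<Rightarrow> (int \<Rightarrow> 'a)) set"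
    and \<Sigma> :: "'c set"
  assumes "comm_group A" and "finite (carrier A)" and "card (carrier A) > 1"
    and "alphabet \<Gamma>"
    and "subgroup H (tfg \<Gamma>)"
    and "move_faithful A \<Gamma> H"
    and "alphabet \<Sigma>"
  shows "\<exists>\<phi>. \<phi> \<in> hom (wreath A ((tfg \<Gamma>)\<lparr>carrier := H\<rparr>)) (tfg \<Sigma>) \<and>
             inj_on \<phi> (carrier (wreath A ((tfg \<Gamma>)\<lparr>carrier := H\<rparr>)))"
proof -
  interpret A: comm_group A by fact
  obtain s0 s1 where s01: "s0 \<in> \<Sigma>" "s1 \<in> \<Sigma>" "s0 \<noteq> s1"
    using alphabet_distinct[OF assms(7)] by blast
  \<comment> \<open>Elements of \<open>hom A A\<close> are arbitrary off the carrier; the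
    extensional ones form a finite set.\<close>
  define E where "E = hom A A \<inter> extensional (carrier A)"
  define C where "C = \<Gamma> \<times> E"
  have "E \<subseteq> carrier A \<rightarrow>\<^sub>E carrier A"
    by (auto simp: E_def hom_def PiE_def)
  then have "finite E"
    using finite_PiE[of "carrier A" "\<lambda>_. carrier A"] assms(2) finite_subset by blast
  then have C_fin: "finite C"
    using assms(4) by (simp add: C_def alphabet_def)
  have restrict_E: "restrict f (carrier A) \<in> E" if "f \<in> hom A A" for f
    using that by (auto simp: E_def hom_def Pi_iff)
  have "\<Gamma> \<noteq> {}" using assms(4) by (auto simp: alphabet_def)
  moreover have "E \<noteq> {}" using restrict_E[of id] by (auto simp: hom_def)
  ultimately have C_ne: "C \<noteq> {}" by (simp add: C_def)
  obtain h where h: "bij_betw h C {0..<int (card C)}"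
    using ex_bij_betw_int[OF C_fin] by blast
  obtain idx where idx: "bij_betw idx (carrier A) {0..<int (card (carrier A))}"
    using ex_bij_betw_int[OF assms(2)] by blast
  define N where "N = int (card (carrier A))"
  \<comment> \<open>Leaves at least \<open>card C\<close> offsets below \<open>m - 2\<close> for the
    marks, and gives \<open>N \<le> m\<close>.\<close>
  define m where "m = int (card C) + N + 2"
  have N_pos: "0 < N" using assms(3) by (simp add: N_def)
  interpret cells \<Sigma> s0 s1 m N
    by unfold_locales (use s01 N_pos in \<open>simp_all add: m_def\<close>)
  have h_C: "h ` C \<subseteq> {0..<m - 2}" "inj_on h C"
    using h N_pos by (auto simp: bij_betw_def m_def)
  define e where "e = inv_into (carrier A) idx"
  \<comment> \<open>The regular action of \<open>A\<close> on itself, transported to the indices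
    \<open>0..<N\<close>; its freeness becomes that of \<open>\<alpha>\<close>.\<close>
  define \<tau> where "\<tau> a j = idx (a \<otimes>\<^bsub>A\<^esub> e j)" for a j
  define \<alpha> where "\<alpha> a = rot (\<tau> a)" for a
  have e_in: "e j \<in> carrier A" "idx (e j) = j" if "0 \<le> j" "j < N" for j
    using that idx bij_betw_inv_into_right[OF idx, of j] inv_into_into[of j idx "carrier A"]
    by (auto simp: e_def N_def bij_betw_def)
  have idx_in: "idx a \<in> {0..<N}" "e (idx a) = a" if "a \<in> carrier A" for a
    using that idx bij_betw_inv_into_left[OF idx] by (auto simp: e_def N_def bij_betw_def)
  have \<tau>: "\<tau> a \<in> {0..<N} \<rightarrow> {0..<N}" if "a \<in> carrier A" for a
    using that e_in idx_in(1) by (auto simp: \<tau>_def Pi_iff)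
  have \<tau>_mult: "\<tau> a (\<tau> b j) = \<tau> (a \<otimes>\<^bsub>A\<^esub> b) j"
    if "a \<in> carrier A" "b \<in> carrier A" "0 \<le> j" "j < N" for a b j
    using that e_in idx_in by (simp add: \<tau>_def A.m_assoc)
  have \<tau>_one: "\<tau> \<one>\<^bsub>A\<^esub> j = j" if "0 \<le> j" "j < N" for j
    using that e_in by (simp add: \<tau>_def)
  have \<alpha>_tfg: "\<alpha> a \<in> carrier (tfg \<Sigma>)" if "a \<in> carrier A" for a
    unfolding \<alpha>_def using that \<tau>
    by (intro rot_tfg[of _ "\<tau> (inv\<^bsub>A\<^esub> a)"]) (simp_all add: \<tau>_mult \<tau>_one)
  have \<alpha>_hom: "\<alpha> \<in> hom A (tfg \<Sigma>)"
  proof (rule homI)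
    fix a b assume ab: "a \<in> carrier A" "b \<in> carrier A"
    show "\<alpha> (a \<otimes>\<^bsub>A\<^esub> b) = \<alpha> a \<otimes>\<^bsub>tfg \<Sigma>\<^esub> \<alpha> b"
    proof (rule tfg_eqI[of _ \<Sigma>])
      fix x assume x: "x \<in> full \<Sigma>"
      show "\<alpha> (a \<otimes>\<^bsub>A\<^esub> b) x = (\<alpha> a \<otimes>\<^bsub>tfg \<Sigma>\<^esub> \<alpha> b) x"
        using x ab \<tau> by (simp add: tfg_mult \<alpha>_def rot_rot) (rule rot_cong, simp_all add: \<tau>_mult)
    qed (use ab in \<open>auto intro!: \<alpha>_tfg tfg_mult_closed\<close>)
  qed (rule \<alpha>_tfg)
  obtain d where d: "d \<in> C" using C_ne by blast
  define lab where "lab = label (decode h C) d"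
  have lab_in: "lab x \<in> C" for x
    using d decode_in[OF C_ne] by (simp add: lab_def label_def)
  have lab_lc: "local_const \<Sigma> lab"
    unfolding lab_def by (rule label_lc[OF decode_lc[OF h_C(1)]])
  interpret W: labelled_action A \<Gamma> H \<Sigma> belt \<alpha> "\<lambda>x. fst (lab x)" "\<lambda>x. snd (lab x)"
  proof (rule labelled_action.intro)
    fix a x assume ax: "a \<in> carrier A" "x \<in> full \<Sigma>"
    have "\<alpha> a x \<in> full \<Sigma>" using tfg_maps[OF \<alpha>_tfg] ax by blast
    then show "belt (\<alpha> a x) = \<alpha> a (belt x)"
      unfolding \<alpha>_def using ax \<tau> by (intro belt_rot)
    have "lab (\<alpha> a x) = lab x"
      unfolding lab_def \<alpha>_def using ax \<tau> by (intro label_rot)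
    then show "fst (lab (\<alpha> a x)) = fst (lab x)" "snd (lab (\<alpha> a x)) = snd (lab x)" by simp_all
  next
    fix x assume "x \<in> full \<Sigma>"
    show "fst (lab x) \<in> \<Gamma>" "snd (lab x) \<in> hom A A"
      using lab_in[of x] by (auto simp: C_def E_def)
  qed (use assms belt_tfg \<alpha>_hom local_const_comp[OF lab_lc] in simp_all)
  have "inj_on W.emb (carrier (wreath A W.G))"
  proof (rule W.emb_inj[OF _ assms(6)])
    fix z and \<gamma> :: "int \<Rightarrow> 'b \<Rightarrow> 'b" assume z: "z \<in> full \<Gamma>" and \<gamma>: "\<And>n. \<gamma> n \<in> hom A A"
    define c where "c n = (z n, restrict (\<gamma> n) (carrier A))" for n
    have c: "c n \<in> C" for n
      using z restrict_E[OF \<gamma>] by (auto simp: c_def C_def in_full_iff)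
    \<comment> \<open>With cells everywhere the belt never turns: \<open>belt\<close> advances by
      one cell at each step and reads \<open>c\<close> in order.\<close>
    define x where "x = encode h c"
    have x: "x \<in> full \<Sigma>" using s01 by (simp add: x_def in_full_iff encode_def Let_def)
    have cell: "cell (shift (2 * m * k) x)" for k
      unfolding x_def by (rule cell_encode[OF c h_C(1)])
    have "belt (shift (2 * m * k) x) = shift (2 * m * (k + 1)) x" for k
      using belt_cells[of "shift (2 * m * k) x"] cell[of k] cell[of "k + 1"] x
      by (simp add: algebra_simps)
    then have "W.Tpow k x = shift (2 * m * k) x" for k
      by (rule W.Tpow_shift[OF x])
    then have "lab (W.Tpow k x) = c k" for k
      using cell[of k] x decode_encode[OF c h_C, of k]
      by (simp add: lab_def label_cell x_def)
    then have "W.zcfg x = z" "\<forall>n. \<forall>a\<in>carrier A. W.ecfg x n a = \<gamma> n a"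
      by (simp_all add: W.zcfg_def W.ecfg_def c_def)
    moreover have "a = \<one>\<^bsub>A\<^esub>" if a: "a \<in> carrier A" and fix_x: "\<alpha> a x = x" for a
    proof -
      \<comment> \<open>The origin of \<open>x\<close> starts a cell, so its state is the lower
        track with element \<open>e 0\<close>; fixing it forces \<open>a\<close> to fix
        \<open>e 0\<close>.\<close>
      have "\<tau> a 0 = 0"
        using rot_free[OF x _ \<tau>[OF a]] cell[of 0] fix_x by (simp add: \<alpha>_def)
      then have "a \<otimes>\<^bsub>A\<^esub> e 0 = e 0"
        using idx_in(2)[of "a \<otimes>\<^bsub>A\<^esub> e 0"] a e_in[of 0] N_pos by (simp add: \<tau>_def)
      then show ?thesis using a e_in[of 0] N_pos by simp
    qed
    ultimately show "\<exists>x\<in>full \<Sigma>. W.zcfg x = z \<and> (\<forall>n. \<forall>a\<in>carrier A. W.ecfg x n a = \<gamma> n a) \<and>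
        (\<forall>a\<in>carrier A. \<alpha> a x = x \<longrightarrow> a = \<one>\<^bsub>A\<^esub>)"
      using x by blast
  qed
  with W.emb_hom show ?thesis
    unfolding W.G_def by blast
qed

end
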